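(* Let $\mathcal{C}$ be a fully triangulated category and let $a_i\xrightarrow{u_i}b_i\xrightarrow{v_i}c_i\xrightarrow{w_i}a_i[1]$, $i=1,2$, be two distinguished $2$-triangles. Then the following $5$-triangle, with objects $x_{i,j}$ ($0\le i<j\le5$), is distinguished. Objects: $x_{0,1}=a_2$, $x_{0,2}=a_1\oplus a_2$, $x_{0,3}=b_1\oplus a_2$, $x_{0,4}=b_1\oplus b_2$, $x_{0,5}=b_2$; $x_{1,2}=a_1$, $x_{1,3}=b_1$, $x_{1,4}=b_1\oplus c_2$, $x_{1,5}=c_2$; $x_{2,3}=c_1$, $x_{2,4}=c_1\oplus c_2$, $x_{2,5}=a_1[1]\oplus c_2$; $x_{3,4}=c_2$, $x_{3,5}=b_1[1]\oplus c_2$; $x_{4,5}=b_1[1]$. Edges $x_{i,j}\to x_{i,j+1}$: $x_{0,1}\to x_{0,2}$: $\begin{pmatrix}0\\1\end{pmatrix}$; $x_{0,2}\to x_{0,3}$: $u_1\oplus1$; $x_{0,3}\to x_{0,4}$: $1\oplus u_2$; $x_{0,4}\to x_{0,5}$: $(0\ 1)$; $x_{1,2}\to x_{1,3}$: $u_1$; $x_{1,3}\to x_{1,4}$: $\begin{pmatrix}1\\0\end{pmatrix}$; $x_{1,4}\to x_{1,5}$: $(0\ 1)$; $x_{2,3}\to x_{2,4}$: $\begin{pmatrix}1\\0\end{pmatrix}$; $x_{2,4}\to x_{2,5}$: $w_1\oplus1$; $x_{3,4}\to x_{3,5}$: $\begin{pmatrix}0\\1\end{pmatrix}$. Edges $x_{i,j}\to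 x_{i+1,j}$: $x_{0,2}\to x_{1,2}$: $(1\ 0)$; $x_{0,3}\to x_{1,3}$: $(1\ 0)$; $x_{0,4}\to x_{1,4}$: $1\oplus v_2$; $x_{0,5}\to x_{1,5}$: $v_2$; $x_{1,3}\to x_{2,3}$: $v_1$; $x_{1,4}\to x_{2,4}$: $v_1\oplus1$; $x_{1,5}\to x_{2,5}$: $\begin{pmatrix}0\\1\end{pmatrix}$; $x_{2,4}\to x_{3,4}$: $(0\ 1)$; $x_{2,5}\to x_{3,5}$: $u_1[1]\oplus1$; $x_{3,5}\to x_{4,5}$: $(1\ 0)$. Edges $x_{i,5}\to x_{0,i}[1]$: $x_{1,5}\to x_{0,1}[1]$: $w_2$; $x_{2,5}\to x_{0,2}[1]$: $1\oplus w_2$; $x_{3,5}\to x_{0,3}[1]$: $1\oplus w_2$; $x_{4,5}\to x_{0,4}[1]$: $\begin{pmatrix}1\\0\end{pmatrix}$. All other edges are the composites of these (for instance $x_{j,k}\to x_{i,j}[1]$ is the composite $x_{j,k}\to x_{j,5}\to x_{0,j}[1]\to x_{i,j}[1]$).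
   Context: Setting. $\mathcal{C}$ is an additive category with an additive automorphism $[1]$. For $n\ge 1$, an $n$-triangle (or $R_n$-diagram) $A$ in $\mathcal{C}$ consists of objects $a_{i,j}$ ($0\le i<j\le n$) and, for all $0\le i<j<k\le n$, morphisms (edges) (i) $a_{i,j}\to a_{i,k}$, (ii) $a_{i,k}\to a_{j,k}$, (iii) $a_{j,k}\to a_{i,j}[1]$ ("degree-one edges"), such that: (S) for each index $m$, the edges among $a_{m,m+1},\dots,a_{m,n},a_{0,m}[1],\dots,a_{m-1,m}[1]$ (shifted where needed) form a commuting diagram, so that each edge is the composite of consecutive ones; (Q) for $i<j<k<l$ the squares $a_{i,k}\to a_{i,l}\to a_{j,l}$ $=$ $a_{i,k}\to a_{j,k}\to a_{j,l}$ and $a_{j,l}\to a_{k,l}\to a_{i,k}[1]$ $=$ $a_{j,l}\to a_{i,j}[1]\to a_{i,k}[1]$ commute. A morphism of $n$-triangles is a family of morphisms between corresponding objects commuting with all edges (with $[1]$ applied where appropriate); this gives a category $\Pi_n$. A $2$-triangle is a diagram $a\xrightarrow{u}b\xrightarrow{v}c\xrightarrow{w}a[1]$ ($a=a_{0,1}$, $b=a_{0,2}$, $c=a_{1,2}$), written $(u,v,w)$, and a morphism $(f,g,h):(u,v,w)\to(u',v',w')$ satisfies $gu=u'f$, $hv=v'g$, $f[1]w=w'h$. Faces and degeneracies. For $0\le m\le n$ the face functor $F_m:\Pi_n\to\Pi_{n-1}$ discards all objects having $m$ as an index (and relabels the remaining indices in order). The degeneracy functor $\Pi_{n-1}\to\Pi_n$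 repeats index $m$: with $s:\{0,\dots,n\}\to\{0,\dots,n-1\}$ the monotone surjection hitting $m$ twice, the new object at $(i,j)$ is $a_{s(i),s(j)}$ if $s(i)\ne s(j)$ and $0$ otherwise, with the evident edges (original edges, identities or zeros). Base. An $(n-1)$-simplex diagram is a commuting diagram on a chain $x_1\to x_2\to\cdots\to x_n$; the base of $A$ is $a_{0,1}\to a_{0,2}\to\cdots\to a_{0,n}$. Rotations. $\tau(A)$ has objects $\tau(A)_{0,j}=a_{j-1,n}$ and $\tau(A)_{i,j}=a_{i-1,j-1}[1]$ for $1\le i<j$, with the corresponding (shifted) edges of $A$ but with all degree-one edges of $\tau(A)$ multiplied by $-1$ (for $n=2$: $b\xrightarrow{v}c\xrightarrow{w}a[1]\xrightarrow{-u[1]}b[1]$). $\sigma(A)$ has objects $a_{i,j}[1]$, shifted edges, with degree-one edges multiplied by $-1$. $\mathcal{C}$ is fully triangulated if for each $n\ge2$ there is given a subcategory $D_n\subset\Pi_n$, whose objects are called distinguished $n$-triangles and whose morphisms are called distinguished morphisms (maps), such that for all $n\geq 2$: (1) Isomorphism: any isomorphism between objects of $D_n$ is distinguished, and any object of $\Pi_n$ isomorphic to a distinguished $n$-triangle is distinguished. (2) Rotation: if $A\in D_n$ then $\tau(A),\sigma(A)\in D_n$. (3) Faces: for $n>2$, face functors send distinguished maps of $n$-triangles to distinguished maps of $(n-1)$-triangles, and degeneracy functors send distinguished maps of $(n-1)$-triangles to distinguished maps of $n$-triangles. (4) Bases: every $(n-1)$-simplex diagram is the base of some distinguished $n$-triangle,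 and every map of $(n-1)$-simplex diagrams $\Sigma\to\Sigma'$ extends to a distinguished map between any given distinguished $n$-triangles with bases $\Sigma,\Sigma'$. (5) Lightning strike: if $(f,g,h)$ and $(f,g,h')$ are distinguished maps between the same two distinguished $2$-triangles $(u,v,w)$ and $(u',v',w')$, then $h'-h=v'\theta w$ for some $\theta:a[1]\to b'$. *)

theory Defs
  imports "HOL-Algebra.Group"
begin

section \<open>Categories\<close>

record ('o, 'm) cat =
  Ob :: "'o set"
  Ar :: "'m set"
  Dom :: "'m \<Rightarrow> 'o"
  Cod :: "'m \<Rightarrow> 'o"
  Id :: "'o \<Rightarrow> 'm"
  Comp :: "'m \<Rightarrow> 'm \<Rightarrow> 'm" (infixl "\<odot>\<index>" 70)

definition Hom :: "('o, 'm, 'z) cat_scheme \<Rightarrow> 'o \<Rightarrow> 'o \<Rightarrow> 'm set" where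
  "Hom C x y = {f \<in> Ar C. Dom C f = x \<and> Cod C f = y}"

locale category =
  fixes C :: "('o, 'm, 'z) cat_scheme" (structure)
  assumes dom_cod: "f \<in> Ar C \<Longrightarrow> Dom C f \<in> Ob C \<and> Cod C f \<in> Ob C"
    and id_hom: "x \<in> Ob C \<Longrightarrow> Id C x \<in> Hom C x x"
    and comp_hom: "\<lbrakk>f \<in> Hom C x y; g \<in> Hom C y z\<rbrakk> \<Longrightarrow> g \<odot> f \<in> Hom C x z"
    and id_left: "f \<in> Hom C x y \<Longrightarrow> Id C y \<odot> f = f"
    and id_right: "f \<in> Hom C x y \<Longrightarrow> f \<odot> Id C x = f"
    and assoc: "\<lbrakk>f \<in> Hom C x y; g \<in> Hom C y z; h \<in> Hom C z w\<rbrakk>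
                 \<Longrightarrow> h \<odot> g \<odot> f = h \<odot> (g \<odot> f)"

definition is_iso :: "('o, 'm, 'z) cat_scheme \<Rightarrow> 'm \<Rightarrow> bool" where
  "is_iso C f \<longleftrightarrow> f \<in> Ar C \<and>
     (\<exists>g \<in> Hom C (Cod C f) (Dom C f).
        g \<odot>\<^bsub>C\<^esub> f = Id C (Dom C f) \<and> f \<odot>\<^bsub>C\<^esub> g = Id C (Cod C f))"

definition is_subcategory :: "('o, 'm, 'z) cat_scheme \<Rightarrow> 'o set \<Rightarrow> 'm set \<Rightarrow> bool" where
  "is_subcategory C X M \<longleftrightarrow>
     X \<subseteq> Ob C \<and> M \<subseteq> Ar C \<and>
     (\<forall>f \<in> M. Dom C f \<in> X \<and> Cod C f \<in> X) \<and>
     (\<forall>x \<in> X. Id C x \<in> M) \<and>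
     (\<forall>f \<in> M. \<forall>g \<in> M. Cod C f = Dom C g \<longrightarrow> g \<odot>\<^bsub>C\<^esub> f \<in> M)"


section \<open>Additive categories with a translation automorphism\<close>

text \<open>\<open>Plus\<close> adds parallel arrows, \<open>Zero x y\<close> is the zero arrow from \<open>x\<close> to \<open>y\<close>;
  \<open>ShO\<close> and \<open>ShA\<close> are the effect of \<open>[1]\<close> on objects and on arrows.\<close>

record ('o, 'm) shift_cat = "('o, 'm) cat" +
  Plus :: "'m \<Rightarrow> 'm \<Rightarrow> 'm" (infixl "\<boxplus>\<index>" 65)
  Zero :: "'o \<Rightarrow> 'o \<Rightarrow> 'm"
  ShO :: "'o \<Rightarrow> 'o"
  ShA :: "'m \<Rightarrow> 'm"

definition hom_group :: "('o, 'm, 'z) shift_cat_scheme \<Rightarrow> 'o \<Rightarrow> 'o \<Rightarrow> 'm monoid" where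
  "hom_group C x y = \<lparr>carrier = Hom C x y, mult = Plus C, one = Zero C x y\<rparr>"

definition neg :: "('o, 'm, 'z) shift_cat_scheme \<Rightarrow> 'm \<Rightarrow> 'm" where
  "neg C f = m_inv (hom_group C (Dom C f) (Cod C f)) f"

definition is_zero_ob :: "('o, 'm, 'z) shift_cat_scheme \<Rightarrow> 'o \<Rightarrow> bool" where
  "is_zero_ob C z \<longleftrightarrow> z \<in> Ob C \<and>
     (\<forall>x \<in> Ob C. (\<exists>!f. f \<in> Hom C x z) \<and> (\<exists>!f. f \<in> Hom C z x))"

record ('o, 'm) biprod =
  Sm :: 'o
  in1 :: 'm
  in2 :: 'm
  pr1 :: 'm
  pr2 :: 'm

definition is_biprod :: "('o, 'm, 'z) shift_cat_scheme \<Rightarrow> 'o \<Rightarrow> 'o \<Rightarrow> ('o, 'm) biprod \<Rightarrow> bool" where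
  "is_biprod C x y B \<longleftrightarrow>
     Sm B \<in> Ob C \<and>
     in1 B \<in> Hom C x (Sm B) \<and> in2 B \<in> Hom C y (Sm B) \<and>
     pr1 B \<in> Hom C (Sm B) x \<and> pr2 B \<in> Hom C (Sm B) y \<and>
     pr1 B \<odot>\<^bsub>C\<^esub> in1 B = Id C x \<and> pr2 B \<odot>\<^bsub>C\<^esub> in2 B = Id C y \<and>
     pr1 B \<odot>\<^bsub>C\<^esub> in2 B = Zero C y x \<and> pr2 B \<odot>\<^bsub>C\<^esub> in1 B = Zero C x y \<and>
     in1 B \<odot>\<^bsub>C\<^esub> pr1 B \<boxplus>\<^bsub>C\<^esub> in2 B \<odot>\<^bsub>C\<^esub> pr2 B = Id C (Sm B)"

locale additive_category = category C
  for C :: "('o, 'm, 'z) shift_cat_scheme" (structure) +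
  assumes hom_comm_group: "\<lbrakk>x \<in> Ob C; y \<in> Ob C\<rbrakk> \<Longrightarrow> comm_group (hom_group C x y)"
    and comp_plus_left: "\<lbrakk>f \<in> Hom C x y; g \<in> Hom C y z; h \<in> Hom C y z\<rbrakk>
                           \<Longrightarrow> (g \<boxplus> h) \<odot> f = g \<odot> f \<boxplus> h \<odot> f"
    and comp_plus_right: "\<lbrakk>f \<in> Hom C x y; g \<in> Hom C x y; h \<in> Hom C y z\<rbrakk>
                           \<Longrightarrow> h \<odot> (f \<boxplus> g) = h \<odot> f \<boxplus> h \<odot> g"
    and ex_zero_ob: "\<exists>z. is_zero_ob C z"
    and ex_biprod: "\<lbrakk>x \<in> Ob C; y \<in> Ob C\<rbrakk> \<Longrightarrow> \<exists>B. is_biprod C x y B"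

locale additive_shift_category = additive_category C
  for C :: "('o, 'm, 'z) shift_cat_scheme" (structure) +
  assumes shift_bij_ob: "bij_betw (ShO C) (Ob C) (Ob C)"
    and shift_bij_ar: "bij_betw (ShA C) (Ar C) (Ar C)"
    and shift_hom: "f \<in> Hom C x y \<Longrightarrow> ShA C f \<in> Hom C (ShO C x) (ShO C y)"
    and shift_id: "x \<in> Ob C \<Longrightarrow> ShA C (Id C x) = Id C (ShO C x)"
    and shift_comp: "\<lbrakk>f \<in> Hom C x y; g \<in> Hom C y z\<rbrakk> \<Longrightarrow> ShA C (g \<odot> f) = ShA C g \<odot> ShA C f"
    and shift_plus: "\<lbrakk>f \<in> Hom C x y; g \<in> Hom C x y\<rbrakk> \<Longrightarrow> ShA C (f \<boxplus> g) = ShA C f \<boxplus> ShA C g"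


section \<open>The category of n-triangles\<close>

text \<open>For \<open>0 \<le> i < j < k \<le> n\<close> the edges of \<open>A\<close> are
  \<open>hor A i j k : a\<^sub>i\<^sub>j \<rightarrow> a\<^sub>i\<^sub>k\<close>, \<open>ver A i j k : a\<^sub>i\<^sub>k \<rightarrow> a\<^sub>j\<^sub>k\<close>
  and \<open>dg1 A i j k : a\<^sub>j\<^sub>k \<rightarrow> a\<^sub>i\<^sub>j[1]\<close>.  All families are \<open>undefined\<close> outside the
  index range, so that equality of records is equality of diagrams.\<close>

record ('o, 'm) tri =
  vtx :: "nat \<Rightarrow> nat \<Rightarrow> 'o"
  hor :: "nat \<Rightarrow> nat \<Rightarrow> nat \<Rightarrow> 'm"
  ver :: "nat \<Rightarrow> nat \<Rightarrow> nat \<Rightarrow> 'm"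
  dg1 :: "nat \<Rightarrow> nat \<Rightarrow> nat \<Rightarrow> 'm"

definition restr2 :: "nat \<Rightarrow> (nat \<Rightarrow> nat \<Rightarrow> 'a) \<Rightarrow> nat \<Rightarrow> nat \<Rightarrow> 'a" where
  "restr2 n f = (\<lambda>i j. if i < j \<and> j \<le> n then f i j else undefined)"

definition restr3 :: "nat \<Rightarrow> (nat \<Rightarrow> nat \<Rightarrow> nat \<Rightarrow> 'a) \<Rightarrow> nat \<Rightarrow> nat \<Rightarrow> nat \<Rightarrow> 'a" where
  "restr3 n f = (\<lambda>i j k. if i < j \<and> j < k \<and> k \<le> n then f i j k else undefined)"

definition restr_tri :: "nat \<Rightarrow> ('o, 'm) tri \<Rightarrow> ('o, 'm) tri" where
  "restr_tri n A = \<lparr>vtx = restr2 n (vtx A), hor = restr3 n (hor A),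
                    ver = restr3 n (ver A), dg1 = restr3 n (dg1 A)\<rparr>"

text \<open>The first four equations are the commuting triangles in the chains
  \<open>a\<^sub>m\<^sub>,\<^sub>m\<^sub>+\<^sub>1 \<rightarrow> \<dots> \<rightarrow> a\<^sub>m\<^sub>n \<rightarrow> a\<^sub>0\<^sub>m[1] \<rightarrow> \<dots> \<rightarrow> a\<^sub>m\<^sub>-\<^sub>1\<^sub>,\<^sub>m[1]\<close>, according to how many of the three
  objects are shifted (for three shifted objects, \<open>[1]\<close> is cancelled).
  The last two are the commuting squares.\<close>

definition is_tri :: "('o, 'm, 'z) shift_cat_scheme \<Rightarrow> nat \<Rightarrow> ('o, 'm) tri \<Rightarrow> bool" where
  "is_tri C n A \<longleftrightarrow> restr_tri n A = A \<and>
     (\<forall>i j. i < j \<and> j \<le> n \<longrightarrow> vtx A i j \<in> Ob C) \<and>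
     (\<forall>i j k. i < j \<and> j < k \<and> k \<le> n \<longrightarrow>
        hor A i j k \<in> Hom C (vtx A i j) (vtx A i k) \<and>
        ver A i j k \<in> Hom C (vtx A i k) (vtx A j k) \<and>
        dg1 A i j k \<in> Hom C (vtx A j k) (ShO C (vtx A i j))) \<and>
     (\<forall>i j k l. i < j \<and> j < k \<and> k < l \<and> l \<le> n \<longrightarrow>
        hor A i k l \<odot>\<^bsub>C\<^esub> hor A i j k = hor A i j l \<and>
        dg1 A i j l \<odot>\<^bsub>C\<^esub> hor A j k l = dg1 A i j k \<and>
        ShA C (ver A i j k) \<odot>\<^bsub>C\<^esub> dg1 A i k l = dg1 A j k l \<and>
        ver A j k l \<odot>\<^bsub>C\<^esub> ver A i j l = ver A i k l \<and>
        ver A i j l \<odot>\<^bsub>C\<^esub> hor A i k l = hor A j k l \<odot>\<^bsub>C\<^esub> ver A i j k \<and>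
        dg1 A i k l \<odot>\<^bsub>C\<^esub> ver A j k l = ShA C (hor A i j k) \<odot>\<^bsub>C\<^esub> dg1 A i j l)"

definition is_tri_map :: "('o, 'm, 'z) shift_cat_scheme \<Rightarrow> nat \<Rightarrow> ('o, 'm) tri \<Rightarrow> ('o, 'm) tri
    \<Rightarrow> (nat \<Rightarrow> nat \<Rightarrow> 'm) \<Rightarrow> bool" where
  "is_tri_map C n A B f \<longleftrightarrow> restr2 n f = f \<and>
     (\<forall>i j. i < j \<and> j \<le> n \<longrightarrow> f i j \<in> Hom C (vtx A i j) (vtx B i j)) \<and>
     (\<forall>i j k. i < j \<and> j < k \<and> k \<le> n \<longrightarrow>
        f i k \<odot>\<^bsub>C\<^esub> hor A i j k = hor B i j k \<odot>\<^bsub>C\<^esub> f i j \<and>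
        f j k \<odot>\<^bsub>C\<^esub> ver A i j k = ver B i j k \<odot>\<^bsub>C\<^esub> f i k \<and>
        ShA C (f i j) \<odot>\<^bsub>C\<^esub> dg1 A i j k = dg1 B i j k \<odot>\<^bsub>C\<^esub> f j k)"

type_synonym ('o, 'm) tri_map = "('o, 'm) tri \<times> ('o, 'm) tri \<times> (nat \<Rightarrow> nat \<Rightarrow> 'm)"

definition Tri :: "('o, 'm, 'z) shift_cat_scheme \<Rightarrow> nat \<Rightarrow> (('o, 'm) tri, ('o, 'm) tri_map) cat" where
  "Tri C n =
    \<lparr>Ob = {A. is_tri C n A},
     Ar = {(A, B, f). is_tri C n A \<and> is_tri C n B \<and> is_tri_map C n A B f},
     Dom = (\<lambda>(A, B, f). A),
     Cod = (\<lambda>(A, B, f). B),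
     Id = (\<lambda>A. (A, A, restr2 n (\<lambda>i j. Id C (vtx A i j)))),
     Comp = (\<lambda>(B', D, g) (A, B, f). (A, D, restr2 n (\<lambda>i j. g i j \<odot>\<^bsub>C\<^esub> f i j)))\<rparr>"

definition tri2 :: "'o \<Rightarrow> 'o \<Rightarrow> 'o \<Rightarrow> 'm \<Rightarrow> 'm \<Rightarrow> 'm \<Rightarrow> ('o, 'm) tri" where
  "tri2 a b c u v w = restr_tri 2
    \<lparr>vtx = (\<lambda>i j. if i = 1 then c else if j = 1 then a else b),
     hor = (\<lambda>i j k. u), ver = (\<lambda>i j k. v), dg1 = (\<lambda>i j k. w)\<rparr>"


subsection \<open>Faces and degeneracies\<close>

definition coface :: "nat \<Rightarrow> nat \<Rightarrow> nat" where
  "coface m i = (if i < m then i else Suc i)"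

text \<open>\<open>face n m\<close> takes n-triangles to (n-1)-triangles.\<close>

definition face :: "nat \<Rightarrow> nat \<Rightarrow> ('o, 'm) tri \<Rightarrow> ('o, 'm) tri" where
  "face n m A = (let d = coface m in restr_tri (n - 1)
    \<lparr>vtx = (\<lambda>i j. vtx A (d i) (d j)),
     hor = (\<lambda>i j k. hor A (d i) (d j) (d k)),
     ver = (\<lambda>i j k. ver A (d i) (d j) (d k)),
     dg1 = (\<lambda>i j k. dg1 A (d i) (d j) (d k))\<rparr>)"

definition face_map :: "nat \<Rightarrow> nat \<Rightarrow> ('o, 'm) tri_map \<Rightarrow> ('o, 'm) tri_map" where
  "face_map n m = (\<lambda>(A, B, f).
     (face n m A, face n m B, restr2 (n - 1) (\<lambda>i j. f (coface m i) (coface m j))))"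

text \<open>A fixed choice of zero object; other choices yield isomorphic degenerate n-triangles.\<close>

definition zero_ob :: "('o, 'm, 'z) shift_cat_scheme \<Rightarrow> 'o" where
  "zero_ob C = (SOME z. is_zero_ob C z)"

definition codegen :: "nat \<Rightarrow> nat \<Rightarrow> nat" where
  "codegen m i = (if i \<le> m then i else i - 1)"

definition degen_vtx :: "('o, 'm, 'z) shift_cat_scheme \<Rightarrow> nat \<Rightarrow> ('o, 'm) tri \<Rightarrow> nat \<Rightarrow> nat \<Rightarrow> 'o" where
  "degen_vtx C m A i j =
     (if codegen m i = codegen m j then zero_ob C else vtx A (codegen m i) (codegen m j))"

text \<open>\<open>degen C n m\<close> takes (n-1)-triangles to n-triangles.  The squares of the result commute
  only if the composites of consecutive edges \<open>a\<^sub>i\<^sub>j \<rightarrow> a\<^sub>i\<^sub>k \<rightarrow> a\<^sub>j\<^sub>k \<rightarrow> a\<^sub>i\<^sub>j[1] \<rightarrow> a\<^sub>i\<^sub>k[1]\<close> of \<open>A\<close> vanish;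
  this is implied by the degeneracy axiom for distinguished \<open>A\<close>.\<close>

definition degen :: "('o, 'm, 'z) shift_cat_scheme \<Rightarrow> nat \<Rightarrow> nat \<Rightarrow> ('o, 'm) tri \<Rightarrow> ('o, 'm) tri" where
  "degen C n m A = (let s = codegen m; a = degen_vtx C m A in restr_tri n
    \<lparr>vtx = a,
     hor = (\<lambda>i j k. if s i = s j then Zero C (a i j) (a i k)
                    else if s j = s k then Id C (a i j)
                    else hor A (s i) (s j) (s k)),
     ver = (\<lambda>i j k. if s i = s j then Id C (a i k)
                    else if s j = s k then Zero C (a i k) (a j k)
                    else ver A (s i) (s j) (s k)),
     dg1 = (\<lambda>i j k. if s i = s j \<or> s j = s k then Zero C (a j k) (ShO C (a i j))
                    else dg1 A (s i) (s j) (s k))\<rparr>)"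

definition degen_map :: "('o, 'm, 'z) shift_cat_scheme \<Rightarrow> nat \<Rightarrow> nat \<Rightarrow> ('o, 'm) tri_map \<Rightarrow> ('o, 'm) tri_map" where
  "degen_map C n m = (\<lambda>(A, B, f).
     (degen C n m A, degen C n m B,
      restr2 n (\<lambda>i j. if codegen m i = codegen m j then Id C (zero_ob C)
                      else f (codegen m i) (codegen m j))))"


subsection \<open>Rotations\<close>

definition tau :: "('o, 'm, 'z) shift_cat_scheme \<Rightarrow> nat \<Rightarrow> ('o, 'm) tri \<Rightarrow> ('o, 'm) tri" where
  "tau C n A = restr_tri n
    \<lparr>vtx = (\<lambda>i j. if i = 0 then vtx A (j - 1) n else ShO C (vtx A (i - 1) (j - 1))),
     hor = (\<lambda>i j k. if i = 0 then ver A (j - 1) (k - 1) n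
                    else ShA C (hor A (i - 1) (j - 1) (k - 1))),
     ver = (\<lambda>i j k. if i = 0 then dg1 A (j - 1) (k - 1) n
                    else ShA C (ver A (i - 1) (j - 1) (k - 1))),
     dg1 = (\<lambda>i j k. if i = 0 then neg C (ShA C (hor A (j - 1) (k - 1) n))
                    else neg C (ShA C (dg1 A (i - 1) (j - 1) (k - 1))))\<rparr>"

definition sigma :: "('o, 'm, 'z) shift_cat_scheme \<Rightarrow> nat \<Rightarrow> ('o, 'm) tri \<Rightarrow> ('o, 'm) tri" where
  "sigma C n A = restr_tri n
    \<lparr>vtx = (\<lambda>i j. ShO C (vtx A i j)),
     hor = (\<lambda>i j k. ShA C (hor A i j k)),
     ver = (\<lambda>i j k. ShA C (ver A i j k)),
     dg1 = (\<lambda>i j k. neg C (ShA C (dg1 A i j k)))\<rparr>"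


subsection \<open>Simplex diagrams and bases\<close>

text \<open>A commuting diagram on the chain \<open>x\<^sub>1 \<rightarrow> \<dots> \<rightarrow> x\<^sub>n\<close> (an (n-1)-simplex diagram) is given with
  all its arrows \<open>arr X j k : x\<^sub>j \<rightarrow> x\<^sub>k\<close>, \<open>1 \<le> j < k \<le> n\<close>.\<close>

record ('o, 'm) simplex =
  pt :: "nat \<Rightarrow> 'o"
  arr :: "nat \<Rightarrow> nat \<Rightarrow> 'm"

definition is_simplex :: "('o, 'm, 'z) shift_cat_scheme \<Rightarrow> nat \<Rightarrow> ('o, 'm) simplex \<Rightarrow> bool" where
  "is_simplex C n X \<longleftrightarrow>
     (\<forall>j. 1 \<le> j \<and> j \<le> n \<longrightarrow> pt X j \<in> Ob C) \<and>
     (\<forall>j k. 1 \<le> j \<and> j < k \<and> k \<le> n \<longrightarrow> arr X j k \<in> Hom C (pt X j) (pt X k)) \<and>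
     (\<forall>j k l. 1 \<le> j \<and> j < k \<and> k < l \<and> l \<le> n \<longrightarrow> arr X k l \<odot>\<^bsub>C\<^esub> arr X j k = arr X j l)"

definition is_simplex_map :: "('o, 'm, 'z) shift_cat_scheme \<Rightarrow> nat \<Rightarrow> ('o, 'm) simplex \<Rightarrow> ('o, 'm) simplex
    \<Rightarrow> (nat \<Rightarrow> 'm) \<Rightarrow> bool" where
  "is_simplex_map C n X Y g \<longleftrightarrow>
     (\<forall>j. 1 \<le> j \<and> j \<le> n \<longrightarrow> g j \<in> Hom C (pt X j) (pt Y j)) \<and>
     (\<forall>j k. 1 \<le> j \<and> j < k \<and> k \<le> n \<longrightarrow> g k \<odot>\<^bsub>C\<^esub> arr X j k = arr Y j k \<odot>\<^bsub>C\<^esub> g j)"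

definition has_base :: "nat \<Rightarrow> ('o, 'm) tri \<Rightarrow> ('o, 'm) simplex \<Rightarrow> bool" where
  "has_base n A X \<longleftrightarrow>
     (\<forall>j. 1 \<le> j \<and> j \<le> n \<longrightarrow> pt X j = vtx A 0 j) \<and>
     (\<forall>j k. 1 \<le> j \<and> j < k \<and> k \<le> n \<longrightarrow> arr X j k = hor A 0 j k)"


section \<open>Fully triangulated categories\<close>

text \<open>\<open>D n\<close> and \<open>M n\<close> are the objects and the arrows of the subcategory of distinguished
  n-triangles and distinguished maps; only their values for \<open>n \<ge> 2\<close> matter.\<close>

locale fully_triangulated = additive_shift_category C
  for C :: "('o, 'm, 'z) shift_cat_scheme" (structure) +
  fixes D :: "nat \<Rightarrow> ('o, 'm) tri set"
    and M :: "nat \<Rightarrow> ('o, 'm) tri_map set"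
  assumes subcategory: "n \<ge> 2 \<Longrightarrow> is_subcategory (Tri C n) (D n) (M n)"
    and iso_map: "\<lbrakk>n \<ge> 2; is_iso (Tri C n) \<phi>; Dom (Tri C n) \<phi> \<in> D n; Cod (Tri C n) \<phi> \<in> D n\<rbrakk>
                    \<Longrightarrow> \<phi> \<in> M n"
    and iso_ob: "\<lbrakk>n \<ge> 2; is_iso (Tri C n) \<phi>; Dom (Tri C n) \<phi> \<in> D n\<rbrakk> \<Longrightarrow> Cod (Tri C n) \<phi> \<in> D n"
    and rotation_tau: "\<lbrakk>n \<ge> 2; A \<in> D n\<rbrakk> \<Longrightarrow> tau C n A \<in> D n"
    and rotation_sigma: "\<lbrakk>n \<ge> 2; A \<in> D n\<rbrakk> \<Longrightarrow> sigma C n A \<in> D n"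
    and faces: "\<lbrakk>n > 2; m \<le> n; \<phi> \<in> M n\<rbrakk> \<Longrightarrow> face_map n m \<phi> \<in> M (n - 1)"
    and degeneracies: "\<lbrakk>n > 2; m \<le> n - 1; \<phi> \<in> M (n - 1)\<rbrakk> \<Longrightarrow> degen_map C n m \<phi> \<in> M n"
    and bases: "\<lbrakk>n \<ge> 2; is_simplex C n X\<rbrakk> \<Longrightarrow> \<exists>A \<in> D n. has_base n A X"
    and base_maps: "\<lbrakk>n \<ge> 2; is_simplex C n X; is_simplex C n Y; is_simplex_map C n X Y g;
                     A \<in> D n; B \<in> D n; has_base n A X; has_base n B Y\<rbrakk>
                     \<Longrightarrow> \<exists>f. (A, B, f) \<in> M n \<and> (\<forall>j. 1 \<le> j \<and> j \<le> n \<longrightarrow> f 0 j = g j)"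
    and lightning: "\<lbrakk>(A, B, f) \<in> M 2; (A, B, f') \<in> M 2; f 0 1 = f' 0 1; f 0 2 = f' 0 2\<rbrakk>
                     \<Longrightarrow> \<exists>\<theta> \<in> Hom C (ShO C (vtx A 0 1)) (vtx B 0 2).
                           f' 1 2 \<boxplus> neg C (f 1 2) = ver B 0 1 2 \<odot> \<theta> \<odot> dg1 A 0 1 2"


section \<open>The 5-triangle built from two 2-triangles\<close>

text \<open>The composite of \<open>d\<close> consecutive arrows \<open>x\<^sub>i \<rightarrow> x\<^sub>i\<^sub>+\<^sub>1 \<rightarrow> \<dots>\<close>, where \<open>e t : x\<^sub>t \<rightarrow> x\<^sub>t\<^sub>+\<^sub>1\<close>.\<close>

primrec path :: "('o, 'm, 'z) cat_scheme \<Rightarrow> (nat \<Rightarrow> 'o) \<Rightarrow> (nat \<Rightarrow> 'm) \<Rightarrow> nat \<Rightarrow> nat \<Rightarrow> 'm" where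
  "path C x e i 0 = Id C (x i)"
| "path C x e i (Suc d) = e (i + d) \<odot>\<^bsub>C\<^esub> path C x e i d"

text \<open>An n-triangle diagram from its consecutive edges \<open>h i j : x\<^sub>i\<^sub>j \<rightarrow> x\<^sub>i\<^sub>,\<^sub>j\<^sub>+\<^sub>1\<close>,
  \<open>v i j : x\<^sub>i\<^sub>j \<rightarrow> x\<^sub>i\<^sub>+\<^sub>1\<^sub>,\<^sub>j\<close> and \<open>w i : x\<^sub>i\<^sub>n \<rightarrow> x\<^sub>0\<^sub>i[1]\<close>; all other edges are composites, the one
  \<open>x\<^sub>j\<^sub>k \<rightarrow> x\<^sub>i\<^sub>j[1]\<close> passing through \<open>x\<^sub>j\<^sub>n\<close> and \<open>x\<^sub>0\<^sub>j[1]\<close>.\<close>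

definition gen_tri :: "('o, 'm, 'z) shift_cat_scheme \<Rightarrow> nat \<Rightarrow> (nat \<Rightarrow> nat \<Rightarrow> 'o)
    \<Rightarrow> (nat \<Rightarrow> nat \<Rightarrow> 'm) \<Rightarrow> (nat \<Rightarrow> nat \<Rightarrow> 'm) \<Rightarrow> (nat \<Rightarrow> 'm) \<Rightarrow> ('o, 'm) tri" where
  "gen_tri C n x h v w =
    (let hh = (\<lambda>i j k. path C (\<lambda>t. x i t) (\<lambda>t. h i t) j (k - j));
         vv = (\<lambda>i j k. path C (\<lambda>t. x t k) (\<lambda>t. v t k) i (j - i))
     in restr_tri n \<lparr>vtx = x, hor = hh, ver = vv,
          dg1 = (\<lambda>i j k. ShA C (vv 0 i j) \<odot>\<^bsub>C\<^esub> w j \<odot>\<^bsub>C\<^esub> hh j k n)\<rparr>)"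

definition shift_biprod :: "('o, 'm, 'z) shift_cat_scheme \<Rightarrow> ('o, 'm) biprod \<Rightarrow> ('o, 'm) biprod" where
  "shift_biprod C B = \<lparr>Sm = ShO C (Sm B), in1 = ShA C (in1 B), in2 = ShA C (in2 B),
                       pr1 = ShA C (pr1 B), pr2 = ShA C (pr2 B)\<rparr>"

definition dsum_map :: "('o, 'm, 'z) shift_cat_scheme \<Rightarrow> ('o, 'm) biprod \<Rightarrow> ('o, 'm) biprod
    \<Rightarrow> 'm \<Rightarrow> 'm \<Rightarrow> 'm" where
  "dsum_map C B B' f g =
     in1 B' \<odot>\<^bsub>C\<^esub> f \<odot>\<^bsub>C\<^esub> pr1 B \<boxplus>\<^bsub>C\<^esub> in2 B' \<odot>\<^bsub>C\<^esub> g \<odot>\<^bsub>C\<^esub> pr2 B"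

text \<open>\<open>S\<close> is a choice of direct sums.  In the edges \<open>x\<^sub>i\<^sub>5 \<rightarrow> x\<^sub>0\<^sub>i[1]\<close> the object \<open>x\<^sub>0\<^sub>i[1]\<close> is a direct
  sum of shifted objects by means of \<open>shift_biprod\<close>.\<close>

definition tri5 :: "('o, 'm, 'z) shift_cat_scheme \<Rightarrow> ('o \<Rightarrow> 'o \<Rightarrow> ('o, 'm) biprod)
    \<Rightarrow> 'o \<Rightarrow> 'o \<Rightarrow> 'o \<Rightarrow> 'm \<Rightarrow> 'm \<Rightarrow> 'm \<Rightarrow> 'o \<Rightarrow> 'o \<Rightarrow> 'o \<Rightarrow> 'm \<Rightarrow> 'm \<Rightarrow> 'm \<Rightarrow> ('o, 'm) tri" where
  "tri5 C S a1 b1 c1 u1 v1 w1 a2 b2 c2 u2 v2 w2 =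
    (let a1' = ShO C a1; b1' = ShO C b1;
         x = (\<lambda>i j. undefined)
           (0 := (\<lambda>j. undefined)(1 := a2, 2 := Sm (S a1 a2), 3 := Sm (S b1 a2),
                                 4 := Sm (S b1 b2), 5 := b2),
            1 := (\<lambda>j. undefined)(2 := a1, 3 := b1, 4 := Sm (S b1 c2), 5 := c2),
            2 := (\<lambda>j. undefined)(3 := c1, 4 := Sm (S c1 c2), 5 := Sm (S a1' c2)),
            3 := (\<lambda>j. undefined)(4 := c2, 5 := Sm (S b1' c2)),
            4 := (\<lambda>j. undefined)(5 := b1'));
         h = (\<lambda>i j. undefined)
           (0 := (\<lambda>j. undefined)(1 := in2 (S a1 a2),
                                 2 := dsum_map C (S a1 a2) (S b1 a2) u1 (Id C a2),
                                 3 := dsum_map C (S b1 a2) (S b1 b2) (Id C b1) u2,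
                                 4 := pr2 (S b1 b2)),
            1 := (\<lambda>j. undefined)(2 := u1, 3 := in1 (S b1 c2), 4 := pr2 (S b1 c2)),
            2 := (\<lambda>j. undefined)(3 := in1 (S c1 c2),
                                 4 := dsum_map C (S c1 c2) (S a1' c2) w1 (Id C c2)),
            3 := (\<lambda>j. undefined)(4 := in2 (S b1' c2)));
         v = (\<lambda>i j. undefined)
           (0 := (\<lambda>j. undefined)(2 := pr1 (S a1 a2), 3 := pr1 (S b1 a2),
                                 4 := dsum_map C (S b1 b2) (S b1 c2) (Id C b1) v2,
                                 5 := v2),
            1 := (\<lambda>j. undefined)(3 := v1,
                                 4 := dsum_map C (S b1 c2) (S c1 c2) v1 (Id C c2),
                                 5 := in2 (S a1' c2)),
            2 := (\<lambda>j. undefined)(4 := pr2 (S c1 c2),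
                                 5 := dsum_map C (S a1' c2) (S b1' c2) (ShA C u1) (Id C c2)),
            3 := (\<lambda>j. undefined)(5 := pr1 (S b1' c2)));
         w = (\<lambda>i. undefined)
           (1 := w2,
            2 := dsum_map C (S a1' c2) (shift_biprod C (S a1 a2)) (Id C a1') w2,
            3 := dsum_map C (S b1' c2) (shift_biprod C (S b1 a2)) (Id C b1') w2,
            4 := in1 (shift_biprod C (S b1 b2)))
     in gen_tri C 5 x h v w)"

end

theory Submission
  imports Defs
begin

text \<open>
  The 5-triangle is a direct sum of two simpler ones, of which each comes from only one of the
  given 2-triangles.  The second summand, with base \<open>a\<^sub>2 = a\<^sub>2 = a\<^sub>2 \<rightarrow> b\<^sub>2 = b\<^sub>2\<close>, is an iterated degeneracy.
  The first one, with base \<open>0 \<rightarrow> a\<^sub>1 \<rightarrow> b\<^sub>1 = b\<^sub>1 \<rightarrow> 0\<close>, is not: it arises from an iterated degeneracy with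
  base \<open>0 \<rightarrow> a\<^sub>1 \<rightarrow> b\<^sub>1 = b\<^sub>1\<close> by appending a zero object to the base.  So it suffices that appending zero
  (\<open>append_zero_D\<close>) and direct sums (\<open>dsum_tri_D\<close>) preserve distinguished diagrams.

  Both facts are instances of one criterion, \<open>D_recognition\<close>.  To show that \<open>G\<close> is distinguished, choose
  a distinguished \<open>Y\<close> with the same base, and find any map \<open>Y \<rightarrow> G\<close> that is the identity on the base.  If
  \<open>Hom(X, -)\<close> is exact along the 2-triangles of \<open>G\<close> on the indices \<open>0, i, j\<close>, then the five lemma makes
  this map an isomorphism, and \<open>D\<close> is closed under isomorphism.

  The exactness of \<open>Hom(X, -)\<close> along distinguished triangles (\<open>D_exact\<close>) comes from the axioms in the
  usual way: a degeneracy shows that consecutive edges compose to zero, lifts are found by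
  extending base maps from a rotated identity triangle, and rotations and faces do the rest.
\<close>

section \<open>Arrow arithmetic\<close>

context category
begin

lemma comp_ar [simp]: "\<lbrakk>f \<in> Ar C; g \<in> Ar C; Dom C g = Cod C f\<rbrakk> \<Longrightarrow> g \<odot> f \<in> Ar C"
  and dom_comp [simp]: "\<lbrakk>f \<in> Ar C; g \<in> Ar C; Dom C g = Cod C f\<rbrakk> \<Longrightarrow> Dom C (g \<odot> f) = Dom C f"
  and cod_comp [simp]: "\<lbrakk>f \<in> Ar C; g \<in> Ar C; Dom C g = Cod C f\<rbrakk> \<Longrightarrow> Cod C (g \<odot> f) = Cod C g"
  using comp_hom[of f "Dom C f" "Cod C f" g "Cod C g"] by (auto simp: Hom_def)

lemma id_ar [simp]: "x \<in> Ob C \<Longrightarrow> Id C x \<in> Ar C"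
  and dom_id [simp]: "x \<in> Ob C \<Longrightarrow> Dom C (Id C x) = x"
  and cod_id [simp]: "x \<in> Ob C \<Longrightarrow> Cod C (Id C x) = x"
  using id_hom[of x] by (auto simp: Hom_def)

lemma dom_ob [simp]: "f \<in> Ar C \<Longrightarrow> Dom C f \<in> Ob C"
  and cod_ob [simp]: "f \<in> Ar C \<Longrightarrow> Cod C f \<in> Ob C"
  using dom_cod by auto

lemma comp_id_left [simp]: "\<lbrakk>f \<in> Ar C; Cod C f = y\<rbrakk> \<Longrightarrow> Id C y \<odot> f = f"
  and comp_id_right [simp]: "\<lbrakk>f \<in> Ar C; Dom C f = x\<rbrakk> \<Longrightarrow> f \<odot> Id C x = f"
  using id_left[of f x y] id_left id_right by (auto simp: Hom_def)

lemma comp_assoc: "\<lbrakk>f \<in> Ar C; g \<in> Ar C; h \<in> Ar C; Dom C g = Cod C f; Dom C h = Cod C g\<rbrakk>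
    \<Longrightarrow> h \<odot> g \<odot> f = h \<odot> (g \<odot> f)"
  using assoc by (auto simp: Hom_def)

end

context additive_category
begin

lemma zero_ar [simp]: "\<lbrakk>x \<in> Ob C; y \<in> Ob C\<rbrakk> \<Longrightarrow> Zero C x y \<in> Ar C"
  and dom_zero [simp]: "\<lbrakk>x \<in> Ob C; y \<in> Ob C\<rbrakk> \<Longrightarrow> Dom C (Zero C x y) = x"
  and cod_zero [simp]: "\<lbrakk>x \<in> Ob C; y \<in> Ob C\<rbrakk> \<Longrightarrow> Cod C (Zero C x y) = y"
  using monoid.one_closed[OF group.is_monoid[OF comm_group.axioms(2)[OF hom_comm_group]], of x y]
  by (auto simp: hom_group_def Hom_def)

lemma plus_hom: "\<lbrakk>f \<in> Hom C x y; g \<in> Hom C x y\<rbrakk> \<Longrightarrow> f \<boxplus> g \<in> Hom C x y"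
  using monoid.m_closed[OF group.is_monoid[OF comm_group.axioms(2)[OF hom_comm_group]], of x y f g]
  by (auto simp: hom_group_def Hom_def)

lemma plus_ar [simp]:
    "\<lbrakk>f \<in> Ar C; g \<in> Ar C; Dom C f = Dom C g; Cod C f = Cod C g\<rbrakk> \<Longrightarrow> f \<boxplus> g \<in> Ar C"
  and dom_plus [simp]:
    "\<lbrakk>f \<in> Ar C; g \<in> Ar C; Dom C f = Dom C g; Cod C f = Cod C g\<rbrakk> \<Longrightarrow> Dom C (f \<boxplus> g) = Dom C g"
  and cod_plus [simp]:
    "\<lbrakk>f \<in> Ar C; g \<in> Ar C; Dom C f = Dom C g; Cod C f = Cod C g\<rbrakk> \<Longrightarrow> Cod C (f \<boxplus> g) = Cod C g"
  using plus_hom[of f "Dom C g" "Cod C g" g] by (auto simp: Hom_def)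

lemma plus_zero_right [simp]: "\<lbrakk>f \<in> Ar C; Dom C f = x; Cod C f = y\<rbrakk> \<Longrightarrow> f \<boxplus> Zero C x y = f"
  and plus_zero_left [simp]: "\<lbrakk>f \<in> Ar C; Dom C f = x; Cod C f = y\<rbrakk> \<Longrightarrow> Zero C x y \<boxplus> f = f"
  using monoid.r_one[OF group.is_monoid[OF comm_group.axioms(2)[OF hom_comm_group]], of x y f]
    monoid.l_one[OF group.is_monoid[OF comm_group.axioms(2)[OF hom_comm_group]], of x y f]
  by (auto simp: hom_group_def Hom_def)

lemma neg_hom: "f \<in> Ar C \<Longrightarrow> neg C f \<in> Hom C (Dom C f) (Cod C f)"
  using group.inv_closed[OF comm_group.axioms(2)[OF hom_comm_group], of "Dom C f" "Cod C f" f]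
  by (auto simp: hom_group_def Hom_def neg_def)

lemma neg_ar [simp]: "f \<in> Ar C \<Longrightarrow> neg C f \<in> Ar C"
  and dom_neg [simp]: "f \<in> Ar C \<Longrightarrow> Dom C (neg C f) = Dom C f"
  and cod_neg [simp]: "f \<in> Ar C \<Longrightarrow> Cod C (neg C f) = Cod C f"
  using neg_hom by (auto simp: Hom_def)

lemma plus_neg [simp]: "f \<in> Ar C \<Longrightarrow> f \<boxplus> neg C f = Zero C (Dom C f) (Cod C f)"
  using group.r_inv[OF comm_group.axioms(2)[OF hom_comm_group], of "Dom C f" "Cod C f" f]
  by (auto simp: hom_group_def Hom_def neg_def)

lemma plus_assoc:
  assumes "f \<in> Ar C" "g \<in> Ar C" "h \<in> Ar C" "Dom C f = Dom C g" "Cod C f = Cod C g"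
    "Dom C g = Dom C h" "Cod C g = Cod C h"
  shows "f \<boxplus> g \<boxplus> h = f \<boxplus> (g \<boxplus> h)"
  using assms monoid.m_assoc[OF group.is_monoid[OF comm_group.axioms(2)[OF hom_comm_group]],
    of "Dom C h" "Cod C h" f g h]
  by (auto simp: hom_group_def Hom_def)

lemma plus_comm:
  assumes "f \<in> Ar C" "g \<in> Ar C" "Dom C f = Dom C g" "Cod C f = Cod C g"
  shows "f \<boxplus> g = g \<boxplus> f"
  using assms comm_monoid.m_comm[OF comm_group.axioms(1)[OF hom_comm_group],
    of "Dom C g" "Cod C g" f g]
  by (auto simp: hom_group_def Hom_def)

lemma plus_left_cancel:
  assumes "f \<boxplus> g = f \<boxplus> h" "f \<in> Ar C" "g \<in> Ar C" "h \<in> Ar C"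
    "Dom C f = Dom C g" "Cod C f = Cod C g" "Dom C f = Dom C h" "Cod C f = Cod C h"
  shows "g = h"
proof -
  have "g \<boxplus> f = h \<boxplus> f"
    using assms plus_comm[of f g] plus_comm[of f h] by simp
  then show ?thesis
    using assms(2-) group.right_cancel[OF comm_group.axioms(2)[OF hom_comm_group],
      of "Dom C h" "Cod C h" f g h]
    by (auto simp: hom_group_def Hom_def)
qed

lemma distrib_left: "\<lbrakk>f \<in> Ar C; g \<in> Ar C; h \<in> Ar C; Dom C f = Dom C g; Cod C f = Cod C g;
    Dom C h = Cod C g\<rbrakk> \<Longrightarrow> h \<odot> (f \<boxplus> g) = h \<odot> f \<boxplus> h \<odot> g"
  using comp_plus_right[of f "Dom C g" "Cod C g" g h "Cod C h"] by (auto simp: Hom_def)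

lemma distrib_right: "\<lbrakk>f \<in> Ar C; g \<in> Ar C; h \<in> Ar C; Dom C g = Dom C h; Cod C g = Cod C h;
    Dom C h = Cod C f\<rbrakk> \<Longrightarrow> (g \<boxplus> h) \<odot> f = g \<odot> f \<boxplus> h \<odot> f"
  using comp_plus_left[of f "Dom C f" "Cod C f" g "Cod C h" h] by (auto simp: Hom_def)

lemma zero_comp [simp]:
  assumes "f \<in> Ar C" "Cod C f = y" "z \<in> Ob C"
  shows "Zero C y z \<odot> f = Zero C (Dom C f) z"
proof (rule plus_left_cancel)
  show "Zero C y z \<odot> f \<boxplus> Zero C y z \<odot> f = Zero C y z \<odot> f \<boxplus> Zero C (Dom C f) z"
    using assms distrib_right[of f "Zero C y z" "Zero C y z"] by auto
qed (use assms in auto)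

lemma comp_zero [simp]:
  assumes "f \<in> Ar C" "Dom C f = y" "x \<in> Ob C"
  shows "f \<odot> Zero C x y = Zero C x (Cod C f)"
proof (rule plus_left_cancel)
  show "f \<odot> Zero C x y \<boxplus> f \<odot> Zero C x y = f \<odot> Zero C x y \<boxplus> Zero C x (Cod C f)"
    using assms distrib_left[of "Zero C x y" "Zero C x y" f] by auto
qed (use assms in auto)

lemma neg_unique:
  assumes "f \<boxplus> g = Zero C (Dom C f) (Cod C f)" "f \<in> Ar C" "g \<in> Ar C"
    "Dom C f = Dom C g" "Cod C f = Cod C g"
  shows "g = neg C f"
  by (rule plus_left_cancel[of f]) (use assms in auto)

lemma neg_comp:
  assumes "f \<in> Ar C" "g \<in> Ar C" "Dom C g = Cod C f"
  shows "neg C g \<odot> f = neg C (g \<odot> f)"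
  by (rule neg_unique) (use assms in \<open>auto simp flip: distrib_right\<close>)

lemma comp_neg:
  assumes "f \<in> Ar C" "g \<in> Ar C" "Dom C g = Cod C f"
  shows "g \<odot> neg C f = neg C (g \<odot> f)"
  by (rule neg_unique) (use assms in \<open>auto simp flip: distrib_left\<close>)

lemma neg_zero [simp]: "\<lbrakk>x \<in> Ob C; y \<in> Ob C\<rbrakk> \<Longrightarrow> neg C (Zero C x y) = Zero C x y"
  by (rule neg_unique[symmetric]) auto

lemma neg_neg [simp]: "f \<in> Ar C \<Longrightarrow> neg C (neg C f) = f"
  by (rule neg_unique[symmetric]) (auto simp: plus_comm[of "neg C f" f])

lemma zero_ob_is_zero: "is_zero_ob C (zero_ob C)"
  unfolding zero_ob_def using ex_zero_ob by (rule someI_ex)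

lemma zero_ob_ob [simp]: "zero_ob C \<in> Ob C"
  using zero_ob_is_zero by (simp add: is_zero_ob_def)

lemma id_zero_ob: "Id C (zero_ob C) = Zero C (zero_ob C) (zero_ob C)"
proof -
  have "\<exists>!f. f \<in> Hom C (zero_ob C) (zero_ob C)"
    using zero_ob_is_zero by (simp add: is_zero_ob_def)
  then show ?thesis by (auto simp: Hom_def)
qed

text \<open>A zero object is used below only through the equation \<open>1 = 0\<close> for its endomorphisms.  Unlike the
  universal property, this equation is visibly preserved by \<open>[1]\<close>.\<close>

lemma into_zero_object:
  assumes "Id C z = Zero C z z" "f \<in> Ar C" "Cod C f = z"
  shows "f = Zero C (Dom C f) z"
  using assms comp_id_left[of f z] zero_comp[of f z z] by auto

lemma from_zero_object:
  assumes "Id C z = Zero C z z" "f \<in> Ar C" "Dom C f = z"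
  shows "f = Zero C z (Cod C f)"
  using assms comp_id_right[of f z] comp_zero[of f z z] by auto

end

context additive_shift_category
begin

lemma sh_ob [simp]: "x \<in> Ob C \<Longrightarrow> ShO C x \<in> Ob C"
  using shift_bij_ob by (auto simp: bij_betw_def)

lemma sh_ar [simp]: "f \<in> Ar C \<Longrightarrow> ShA C f \<in> Ar C"
  and dom_sh [simp]: "f \<in> Ar C \<Longrightarrow> Dom C (ShA C f) = ShO C (Dom C f)"
  and cod_sh [simp]: "f \<in> Ar C \<Longrightarrow> Cod C (ShA C f) = ShO C (Cod C f)"
  using shift_hom[of f "Dom C f" "Cod C f"] by (auto simp: Hom_def)

lemma sh_comp: "\<lbrakk>f \<in> Ar C; g \<in> Ar C; Dom C g = Cod C f\<rbrakk> \<Longrightarrow> ShA C (g \<odot> f) = ShA C g \<odot> ShA C f"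
  using shift_comp[of f "Dom C f" "Cod C f" g "Cod C g"] by (auto simp: Hom_def)

lemma sh_plus: "\<lbrakk>f \<in> Ar C; g \<in> Ar C; Dom C f = Dom C g; Cod C f = Cod C g\<rbrakk>
    \<Longrightarrow> ShA C (f \<boxplus> g) = ShA C f \<boxplus> ShA C g"
  using shift_plus[of f "Dom C f" "Cod C f" g] by (auto simp: Hom_def)

lemma sh_zero [simp]:
  assumes "x \<in> Ob C" "y \<in> Ob C"
  shows "ShA C (Zero C x y) = Zero C (ShO C x) (ShO C y)"
  by (rule plus_left_cancel[of "ShA C (Zero C x y)"])
    (use assms sh_plus[of "Zero C x y" "Zero C x y"] in auto)

lemma sh_inj: "\<lbrakk>ShA C f = ShA C g; f \<in> Ar C; g \<in> Ar C\<rbrakk> \<Longrightarrow> f = g"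
  using shift_bij_ar by (auto simp: bij_betw_def inj_on_def)

lemma sh_full:
  assumes "f \<in> Ar C" "Dom C f = ShO C x" "Cod C f = ShO C y" "x \<in> Ob C" "y \<in> Ob C"
  obtains g where "g \<in> Ar C" "Dom C g = x" "Cod C g = y" "f = ShA C g"
proof -
  obtain g where g: "g \<in> Ar C" "f = ShA C g"
    using shift_bij_ar assms(1) by (auto simp: bij_betw_def)
  have "inj_on (ShO C) (Ob C)" using shift_bij_ob by (auto simp: bij_betw_def)
  moreover have "ShO C (Dom C g) = ShO C x" "ShO C (Cod C g) = ShO C y"
    using g assms(2,3) by auto
  ultimately have "Dom C g = x" "Cod C g = y"
    using g(1) assms(4,5) by (auto dest: inj_onD)
  then show thesis using g that by blast
qed

lemma id_zero_ob_sh: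
  "Id C (ShO C (zero_ob C)) = Zero C (ShO C (zero_ob C)) (ShO C (zero_ob C))"
  by (metis id_zero_ob shift_id sh_zero zero_ob_ob)

end

section \<open>Direct sums of arrows\<close>

definition pair_into :: "('o, 'm, 'z) shift_cat_scheme \<Rightarrow> ('o, 'm) biprod \<Rightarrow> 'm \<Rightarrow> 'm \<Rightarrow> 'm" where
  "pair_into C B f g = in1 B \<odot>\<^bsub>C\<^esub> f \<boxplus>\<^bsub>C\<^esub> in2 B \<odot>\<^bsub>C\<^esub> g"

context additive_category
begin

lemma biprodD:
  assumes "is_biprod C x y B"
  shows "Sm B \<in> Ob C"
    "in1 B \<in> Ar C" "Dom C (in1 B) = x" "Cod C (in1 B) = Sm B"
    "in2 B \<in> Ar C" "Dom C (in2 B) = y" "Cod C (in2 B) = Sm B"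
    "pr1 B \<in> Ar C" "Dom C (pr1 B) = Sm B" "Cod C (pr1 B) = x"
    "pr2 B \<in> Ar C" "Dom C (pr2 B) = Sm B" "Cod C (pr2 B) = y"
    "pr1 B \<odot> in1 B = Id C x" "pr2 B \<odot> in2 B = Id C y"
    "pr1 B \<odot> in2 B = Zero C y x" "pr2 B \<odot> in1 B = Zero C x y"
    "in1 B \<odot> pr1 B \<boxplus> in2 B \<odot> pr2 B = Id C (Sm B)"
    "x \<in> Ob C" "y \<in> Ob C"
  using assms unfolding is_biprod_def Hom_def by auto

lemma pair_into_ar:
  assumes "is_biprod C x y B" "f \<in> Ar C" "g \<in> Ar C" "Dom C f = Dom C g" "Cod C f = x" "Cod C g = y"
  shows "pair_into C B f g \<in> Ar C" "Dom C (pair_into C B f g) = Dom C g"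
    "Cod C (pair_into C B f g) = Sm B"
    "pr1 B \<odot> pair_into C B f g = f" "pr2 B \<odot> pair_into C B f g = g"
  using assms(2-) biprodD[OF assms(1)]
  by (auto simp: pair_into_def distrib_left simp flip: comp_assoc)

lemma biprod_ext:
  assumes "is_biprod C x y B" "f \<in> Ar C" "g \<in> Ar C" "Dom C f = Dom C g"
    "Cod C f = Sm B" "Cod C g = Sm B" "pr1 B \<odot> f = pr1 B \<odot> g" "pr2 B \<odot> f = pr2 B \<odot> g"
  shows "f = g"
proof -
  have "h = in1 B \<odot> (pr1 B \<odot> h) \<boxplus> in2 B \<odot> (pr2 B \<odot> h)" if "h \<in> Ar C" "Cod C h = Sm B" for h
    using that biprodD[OF assms(1)]
      distrib_right[of h "in1 B \<odot> pr1 B" "in2 B \<odot> pr2 B"] by (simp add: comp_assoc)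
  from this[of f] this[of g] show ?thesis using assms by simp
qed

lemma dsum_ar:
  assumes "is_biprod C x y B" "is_biprod C x' y' B'"
    "f \<in> Ar C" "g \<in> Ar C" "Dom C f = x" "Cod C f = x'" "Dom C g = y" "Cod C g = y'"
  shows "dsum_map C B B' f g \<in> Ar C" "Dom C (dsum_map C B B' f g) = Sm B"
    "Cod C (dsum_map C B B' f g) = Sm B'"
    "pr1 B' \<odot> dsum_map C B B' f g = f \<odot> pr1 B" "pr2 B' \<odot> dsum_map C B B' f g = g \<odot> pr2 B"
proof -
  have eq: "dsum_map C B B' f g = pair_into C B' (f \<odot> pr1 B) (g \<odot> pr2 B)"
    using assms(3-) biprodD[OF assms(1)] biprodD[OF assms(2)]
    by (simp add: dsum_map_def pair_into_def comp_assoc)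
  show "dsum_map C B B' f g \<in> Ar C" "Dom C (dsum_map C B B' f g) = Sm B"
    "Cod C (dsum_map C B B' f g) = Sm B'"
    "pr1 B' \<odot> dsum_map C B B' f g = f \<odot> pr1 B" "pr2 B' \<odot> dsum_map C B B' f g = g \<odot> pr2 B"
    unfolding eq using assms(3-) biprodD[OF assms(1)] biprodD[OF assms(2)]
      pair_into_ar[OF assms(2), of "f \<odot> pr1 B" "g \<odot> pr2 B"] by auto
qed

lemma dsum_comp:
  assumes B: "is_biprod C x y B" and B': "is_biprod C x' y' B'" and B'': "is_biprod C x'' y'' B''"
    and f: "f \<in> Ar C" "g \<in> Ar C" "Dom C f = x" "Cod C f = x'" "Dom C g = y" "Cod C g = y'"
    and f': "f' \<in> Ar C" "g' \<in> Ar C" "Dom C f' = x'" "Cod C f' = x''" "Dom C g' = y'" "Cod C g' = y''"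
  shows "dsum_map C B' B'' f' g' \<odot> dsum_map C B B' f g = dsum_map C B B'' (f' \<odot> f) (g' \<odot> g)"
proof (rule biprod_ext[OF B''])
  note [simp] = dsum_ar[OF B B' f] dsum_ar[OF B' B'' f']
    dsum_ar[OF B B'', of "f' \<odot> f" "g' \<odot> g"] biprodD[OF B] biprodD[OF B'] biprodD[OF B''] f f'
  have "pr1 B'' \<odot> (dsum_map C B' B'' f' g' \<odot> dsum_map C B B' f g)
      = (pr1 B'' \<odot> dsum_map C B' B'' f' g') \<odot> dsum_map C B B' f g"
    by (rule comp_assoc[symmetric]) auto
  then show "pr1 B'' \<odot> (dsum_map C B' B'' f' g' \<odot> dsum_map C B B' f g)
      = pr1 B'' \<odot> dsum_map C B B'' (f' \<odot> f) (g' \<odot> g)"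
    by (simp add: comp_assoc)
  have "pr2 B'' \<odot> (dsum_map C B' B'' f' g' \<odot> dsum_map C B B' f g)
      = (pr2 B'' \<odot> dsum_map C B' B'' f' g') \<odot> dsum_map C B B' f g"
    by (rule comp_assoc[symmetric]) auto
  then show "pr2 B'' \<odot> (dsum_map C B' B'' f' g' \<odot> dsum_map C B B' f g)
      = pr2 B'' \<odot> dsum_map C B B'' (f' \<odot> f) (g' \<odot> g)"
    by (simp add: comp_assoc)
qed (use dsum_ar[OF B B' f] dsum_ar[OF B' B'' f']
    dsum_ar[OF B B'', of "f' \<odot> f" "g' \<odot> g"] f f' in auto)

end

context additive_shift_category
begin

lemma is_biprod_shift:
  assumes "is_biprod C x y B"
  shows "is_biprod C (ShO C x) (ShO C y) (shift_biprod C B)"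
  using biprodD[OF assms]
  by (auto simp: is_biprod_def shift_biprod_def Hom_def shift_id simp flip: sh_comp sh_plus)

lemma shift_dsum:
  assumes "is_biprod C x y B" "is_biprod C x' y' B'"
    "f \<in> Ar C" "g \<in> Ar C" "Dom C f = x" "Cod C f = x'" "Dom C g = y" "Cod C g = y'"
  shows "ShA C (dsum_map C B B' f g)
    = dsum_map C (shift_biprod C B) (shift_biprod C B') (ShA C f) (ShA C g)"
  using assms(3-) biprodD[OF assms(1)] biprodD[OF assms(2)]
  by (simp add: dsum_map_def shift_biprod_def sh_comp sh_plus)

end

section \<open>Diagrams and their isomorphisms\<close>

lemma tri_ob: "\<lbrakk>is_tri C n A; i < j; j \<le> n\<rbrakk> \<Longrightarrow> vtx A i j \<in> Ob C"
  by (simp add: is_tri_def)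

lemma tri_edges:
  assumes "is_tri C n A" "i < j" "j < k" "k \<le> n"
  shows "hor A i j k \<in> Ar C" "Dom C (hor A i j k) = vtx A i j" "Cod C (hor A i j k) = vtx A i k"
    "ver A i j k \<in> Ar C" "Dom C (ver A i j k) = vtx A i k" "Cod C (ver A i j k) = vtx A j k"
    "dg1 A i j k \<in> Ar C" "Dom C (dg1 A i j k) = vtx A j k"
    "Cod C (dg1 A i j k) = ShO C (vtx A i j)"
  using assms unfolding is_tri_def Hom_def by blast+

lemma tri_comm:
  assumes "is_tri C n A" "i < j" "j < k" "k < l" "l \<le> n"
  shows "hor A i k l \<odot>\<^bsub>C\<^esub> hor A i j k = hor A i j l"
    "dg1 A i j l \<odot>\<^bsub>C\<^esub> hor A j k l = dg1 A i j k"
    "ShA C (ver A i j k) \<odot>\<^bsub>C\<^esub> dg1 A i k l = dg1 A j k l"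
    "ver A j k l \<odot>\<^bsub>C\<^esub> ver A i j l = ver A i k l"
    "ver A i j l \<odot>\<^bsub>C\<^esub> hor A i k l = hor A j k l \<odot>\<^bsub>C\<^esub> ver A i j k"
    "dg1 A i k l \<odot>\<^bsub>C\<^esub> ver A j k l = ShA C (hor A i j k) \<odot>\<^bsub>C\<^esub> dg1 A i j l"
  using assms unfolding is_tri_def by blast+

lemma tri_map_ar:
  assumes "is_tri_map C n A B f" "i < j" "j \<le> n"
  shows "f i j \<in> Ar C" "Dom C (f i j) = vtx A i j" "Cod C (f i j) = vtx B i j"
  using assms unfolding is_tri_map_def Hom_def by auto

lemma tri_map_comm:
  assumes "is_tri_map C n A B f" "i < j" "j < k" "k \<le> n"
  shows "f i k \<odot>\<^bsub>C\<^esub> hor A i j k = hor B i j k \<odot>\<^bsub>C\<^esub> f i j"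
    "f j k \<odot>\<^bsub>C\<^esub> ver A i j k = ver B i j k \<odot>\<^bsub>C\<^esub> f i k"
    "ShA C (f i j) \<odot>\<^bsub>C\<^esub> dg1 A i j k = dg1 B i j k \<odot>\<^bsub>C\<^esub> f j k"
  using assms unfolding is_tri_map_def by blast+

lemmas restr_defs = restr_tri_def restr2_def restr3_def

lemma restr_tri_sel [simp]:
  "i < j \<Longrightarrow> j \<le> n \<Longrightarrow> vtx (restr_tri n A) i j = vtx A i j"
  "i < j \<Longrightarrow> j < k \<Longrightarrow> k \<le> n \<Longrightarrow> hor (restr_tri n A) i j k = hor A i j k"
  "i < j \<Longrightarrow> j < k \<Longrightarrow> k \<le> n \<Longrightarrow> ver (restr_tri n A) i j k = ver A i j k"
  "i < j \<Longrightarrow> j < k \<Longrightarrow> k \<le> n \<Longrightarrow> dg1 (restr_tri n A) i j k = dg1 A i j k"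
  by (simp_all add: restr_defs)

lemma restr2_sel [simp]: "i < j \<Longrightarrow> j \<le> n \<Longrightarrow> restr2 n f i j = f i j"
  by (simp add: restr2_def)

lemma restr_tri_idem [simp]: "restr_tri n (restr_tri n A) = restr_tri n A"
  by (auto simp: restr_defs intro!: ext)

lemma restr2_idem [simp]: "restr2 n (restr2 n f) = restr2 n f"
  by (auto simp: restr2_def intro!: ext)

lemma tri_eqI:
  assumes "is_tri C n A" "restr_tri n B = B"
    and "\<And>i j. \<lbrakk>i < j; j \<le> n\<rbrakk> \<Longrightarrow> vtx B i j = vtx A i j"
    and "\<And>i j k. \<lbrakk>i < j; j < k; k \<le> n\<rbrakk> \<Longrightarrow> hor B i j k = hor A i j k"
    and "\<And>i j k. \<lbrakk>i < j; j < k; k \<le> n\<rbrakk> \<Longrightarrow> ver B i j k = ver A i j k"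
    and "\<And>i j k. \<lbrakk>i < j; j < k; k \<le> n\<rbrakk> \<Longrightarrow> dg1 B i j k = dg1 A i j k"
  shows "B = A"
proof -
  have "restr_tri n A = A" using assms(1) by (simp add: is_tri_def)
  moreover have "restr_tri n B = restr_tri n A"
    using assms(3-) by (auto simp: restr_defs intro!: ext)
  ultimately show ?thesis using assms(2) by simp
qed

context category
begin

text \<open>A commuting square whose two parallel sides are invertible still commutes after these sides are
  replaced by their inverses; hence the componentwise inverse of a map of n-triangles is again one.\<close>

lemma inverse_transfer:
  assumes "p \<in> Ar C" "q \<in> Ar C" "f \<in> Ar C" "g \<in> Ar C" "f' \<in> Ar C" "g' \<in> Ar C"
    and "Dom C f = Dom C p" "Dom C f' = Cod C p" "Cod C f = Dom C q" "Cod C f' = Cod C q"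
    and "Dom C g = Cod C f" "Cod C g = Dom C f" "Dom C g' = Cod C f'" "Cod C g' = Dom C f'"
    and "f' \<odot> p = q \<odot> f" "f \<odot> g = Id C (Cod C f)" "g' \<odot> f' = Id C (Dom C f')"
  shows "g' \<odot> q = p \<odot> g"
proof -
  have "g' \<odot> q = g' \<odot> (q \<odot> f \<odot> g)"
    using assms by (simp add: comp_assoc)
  also have "\<dots> = g' \<odot> f' \<odot> (p \<odot> g)"
    using assms(1-14) by (simp add: comp_assoc flip: assms(15))
  also have "\<dots> = p \<odot> g" using assms by simp
  finally show ?thesis .
qed

end

context additive_shift_category
begin

lemma tri_map_is_iso:
  assumes Y: "is_tri C n Y" and G: "is_tri C n G" and f: "is_tri_map C n Y G f"
    and inv: "\<And>i j. \<lbrakk>i < j; j \<le> n\<rbrakk> \<Longrightarrow> \<exists>g. g \<in> Ar C \<and> Dom C g = vtx G i j \<and> Cod C g = vtx Y i j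
      \<and> g \<odot> f i j = Id C (vtx Y i j) \<and> f i j \<odot> g = Id C (vtx G i j)"
  shows "is_iso (Tri C n) (Y, G, f)"
proof -
  have "\<forall>i j. \<exists>g. i < j \<and> j \<le> n \<longrightarrow> g \<in> Ar C \<and> Dom C g = vtx G i j \<and> Cod C g = vtx Y i j
      \<and> g \<odot> f i j = Id C (vtx Y i j) \<and> f i j \<odot> g = Id C (vtx G i j)"
    using inv by blast
  then obtain g where g: "\<And>i j. \<lbrakk>i < j; j \<le> n\<rbrakk> \<Longrightarrow> g i j \<in> Ar C \<and> Dom C (g i j) = vtx G i j
      \<and> Cod C (g i j) = vtx Y i j
      \<and> g i j \<odot> f i j = Id C (vtx Y i j) \<and> f i j \<odot> g i j = Id C (vtx G i j)"
    by metis
  note [simp] = tri_edges[OF Y] tri_edges[OF G] tri_ob[OF Y] tri_ob[OF G] tri_map_ar[OF f]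
  have "is_tri_map C n G Y (restr2 n g)"
    unfolding is_tri_map_def
  proof (intro conjI allI impI)
    fix i j k assume "i < j \<and> j < k \<and> k \<le> n"
    then have l: "i < j" "j < k" "i < k" "k \<le> n" "j \<le> n" by auto
    have "g i k \<odot> hor G i j k = hor Y i j k \<odot> g i j"
      by (rule inverse_transfer[where f = "f i j" and f' = "f i k"])
        (use l g[of i j] g[of i k] tri_map_comm[OF f l(1,2,4)] in auto)
    then show "restr2 n g i k \<odot> hor G i j k = hor Y i j k \<odot> restr2 n g i j"
      using l by simp
    have "g j k \<odot> ver G i j k = ver Y i j k \<odot> g i k"
      by (rule inverse_transfer[where f = "f i k" and f' = "f j k"])
        (use l g[of j k] g[of i k] tri_map_comm[OF f l(1,2,4)] in auto)
    then show "restr2 n g j k \<odot> ver G i j k = ver Y i j k \<odot> restr2 n g i k"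
      using l by simp
    have "ShA C (g i j) \<odot> dg1 G i j k = dg1 Y i j k \<odot> g j k"
      by (rule inverse_transfer[where f = "f j k" and f' = "ShA C (f i j)"])
        (use l g[of j k] g[of i j] tri_map_comm[OF f l(1,2,4)] in
          \<open>auto simp: shift_id simp flip: sh_comp\<close>)
    then show "ShA C (restr2 n g i j) \<odot> dg1 G i j k = dg1 Y i j k \<odot> restr2 n g j k"
      using l by simp
  qed (use g in \<open>auto simp: Hom_def\<close>)
  moreover have "restr2 n (\<lambda>i j. restr2 n g i j \<odot> f i j) = restr2 n (\<lambda>i j. Id C (vtx Y i j))"
    "restr2 n (\<lambda>i j. f i j \<odot> restr2 n g i j) = restr2 n (\<lambda>i j. Id C (vtx G i j))"
    using g by (auto simp: restr2_def intro!: ext)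
  ultimately show ?thesis
    unfolding is_iso_def Tri_def Hom_def using Y G f by auto
qed

end

section \<open>Exactness of distinguished diagrams\<close>

text \<open>Exactness of \<open>Hom(X, -)\<close>, for every \<open>X\<close>, on two composable arrows \<open>f\<close>, \<open>g\<close>.\<close>

definition hom_exact :: "('o, 'm, 'z) shift_cat_scheme \<Rightarrow> 'm \<Rightarrow> 'm \<Rightarrow> bool" where
  "hom_exact C f g \<longleftrightarrow> g \<odot>\<^bsub>C\<^esub> f = Zero C (Dom C f) (Cod C g) \<and>
     (\<forall>z \<in> Ar C. Cod C z = Dom C g \<and> g \<odot>\<^bsub>C\<^esub> z = Zero C (Dom C z) (Cod C g) \<longrightarrow>
        (\<exists>t \<in> Ar C. Dom C t = Dom C z \<and> Cod C t = Dom C f \<and> z = f \<odot>\<^bsub>C\<^esub> t))"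

text \<open>Exactness along the 2-triangle on the indices \<open>0\<close>, \<open>i\<close>, \<open>j\<close>, up to the object \<open>a\<^sub>0\<^sub>j[1]\<close>.  This is as
  much of the long exact sequence as the five lemma needs.\<close>

definition face_exact :: "('o, 'm, 'z) shift_cat_scheme \<Rightarrow> ('o, 'm) tri \<Rightarrow> nat \<Rightarrow> nat \<Rightarrow> bool" where
  "face_exact C A i j \<longleftrightarrow>
     hom_exact C (hor A 0 i j) (ver A 0 i j) \<and>
     hom_exact C (ver A 0 i j) (dg1 A 0 i j) \<and>
     hom_exact C (dg1 A 0 i j) (ShA C (hor A 0 i j))"

lemma hom_exactD:
  assumes "hom_exact C f g"
  shows "g \<odot>\<^bsub>C\<^esub> f = Zero C (Dom C f) (Cod C g)"
    "\<lbrakk>z \<in> Ar C; Cod C z = Dom C g; g \<odot>\<^bsub>C\<^esub> z = Zero C (Dom C z) (Cod C g)\<rbrakk>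
      \<Longrightarrow> \<exists>t \<in> Ar C. Dom C t = Dom C z \<and> Cod C t = Dom C f \<and> z = f \<odot>\<^bsub>C\<^esub> t"
  using assms unfolding hom_exact_def by blast+

context additive_category
begin

lemma hom_exact_neg_right:
  assumes "hom_exact C f (neg C g)" "f \<in> Ar C" "g \<in> Ar C" "Dom C g = Cod C f"
  shows "hom_exact C f g"
proof -
  have "neg C g \<odot> z = Zero C (Dom C z) (Cod C g) \<longleftrightarrow> g \<odot> z = Zero C (Dom C z) (Cod C g)"
    if "z \<in> Ar C" "Cod C z = Dom C g" for z
  proof -
    have "neg C g \<odot> z = neg C (g \<odot> z)" "neg C (neg C (g \<odot> z)) = g \<odot> z"
      "neg C (Zero C (Dom C z) (Cod C g)) = Zero C (Dom C z) (Cod C g)"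
      using that assms neg_comp[of z g] by auto
    then show ?thesis by metis
  qed
  then show ?thesis using assms unfolding hom_exact_def by auto
qed

text \<open>The five lemma for two exact sequences that share their outer terms.  A lift \<open>t\<close> of \<open>w\<close>
  along \<open>w'\<close> is a right inverse of \<open>h\<close> up to an error that factors as \<open>v \<odot> s\<close>; adding \<open>v' \<odot> s\<close> gives a
  true right inverse \<open>g\<close>.  The defect \<open>d\<close> of \<open>g\<close> as a left inverse is killed by \<open>h\<close>, hence factors through
  \<open>v' \<odot> u = 0\<close>.\<close>

lemma five_lemma:
  assumes "u \<in> Ar C" "v \<in> Ar C" "w \<in> Ar C" "u' \<in> Ar C" "v' \<in> Ar C" "w' \<in> Ar C" "h \<in> Ar C"
    and "Dom C v = Cod C u" "Dom C w = Cod C v" "Dom C u' = Cod C w"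
    and "Dom C v' = Cod C u" "Dom C w' = Cod C v'" "Cod C w' = Cod C w"
    and "Dom C h = Cod C v'" "Cod C h = Cod C v"
    and "h \<odot> v' = v" "w \<odot> h = w'"
    and "hom_exact C u v" "hom_exact C v w" "hom_exact C w u'"
    and "hom_exact C u v'" "hom_exact C v' w'" "hom_exact C w' u'"
  shows "\<exists>g. g \<in> Ar C \<and> Dom C g = Cod C h \<and> Cod C g = Dom C h
    \<and> g \<odot> h = Id C (Dom C h) \<and> h \<odot> g = Id C (Cod C h)"
proof -
  note [simp] = assms(1-15)
  obtain t where t [simp]: "t \<in> Ar C" "Dom C t = Cod C v" "Cod C t = Cod C v'"
    and wt: "w = w' \<odot> t"
    using hom_exactD(2)[OF assms(23), of w] hom_exactD(1)[OF assms(20)] by auto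
  have "w \<odot> (Id C (Cod C v) \<boxplus> neg C (h \<odot> t)) = Zero C (Cod C v) (Cod C w)"
  proof -
    have "w \<odot> (h \<odot> t) = w"
      using comp_assoc[of t h w] assms(17) by (simp flip: wt)
    then show ?thesis
      using plus_neg[of w] by (simp add: distrib_left comp_neg)
  qed
  then obtain s where s [simp]: "s \<in> Ar C" "Dom C s = Cod C v" "Cod C s = Cod C u"
    and vs: "Id C (Cod C v) \<boxplus> neg C (h \<odot> t) = v \<odot> s"
    using hom_exactD(2)[OF assms(19), of "Id C (Cod C v) \<boxplus> neg C (h \<odot> t)"]
    by auto
  define g where "g = t \<boxplus> v' \<odot> s"
  have g [simp]: "g \<in> Ar C" "Dom C g = Cod C v" "Cod C g = Cod C v'"
    by (simp_all add: g_def)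
  have "h \<odot> g = h \<odot> t \<boxplus> (Id C (Cod C v) \<boxplus> neg C (h \<odot> t))"
    by (simp add: g_def distrib_left assms(16) vs flip: comp_assoc)
  also have "\<dots> = h \<odot> t \<boxplus> (neg C (h \<odot> t) \<boxplus> Id C (Cod C v))"
    by (subst (2) plus_comm) simp_all
  also have "\<dots> = Id C (Cod C v)"
    by (subst plus_assoc[symmetric]) simp_all
  finally have hg: "h \<odot> g = Id C (Cod C v)" .
  define d where "d = g \<odot> h \<boxplus> neg C (Id C (Cod C v'))"
  have d [simp]: "d \<in> Ar C" "Dom C d = Cod C v'" "Cod C d = Cod C v'"
    by (simp_all add: d_def)
  have hd: "h \<odot> d = Zero C (Cod C v') (Cod C v)"
    using hg by (simp add: d_def distrib_left comp_neg plus_neg flip: comp_assoc)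
  then have "w' \<odot> d = Zero C (Cod C v') (Cod C w')"
    using comp_assoc[of d h w] assms(17) by simp
  then obtain s' where s': "s' \<in> Ar C" "Dom C s' = Cod C v'" "Cod C s' = Cod C u" "d = v' \<odot> s'"
    using hom_exactD(2)[OF assms(22), of d] by auto
  have "v \<odot> s' = Zero C (Cod C v') (Cod C v)"
    using comp_assoc[of s' v' h] hd s' assms(16) by simp
  then obtain r where r: "r \<in> Ar C" "Dom C r = Cod C v'" "Cod C r = Dom C u" "s' = u \<odot> r"
    using hom_exactD(2)[OF assms(18), of s'] s' by auto
  have "d = Zero C (Cod C v') (Cod C v')"
    using comp_assoc[of r u v'] hom_exactD(1)[OF assms(21)] r s' by simp
  then have "g \<odot> h \<boxplus> neg C (Id C (Cod C v')) = Id C (Cod C v') \<boxplus> neg C (Id C (Cod C v'))"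
    by (simp add: d_def)
  then have "neg C (Id C (Cod C v')) \<boxplus> g \<odot> h = neg C (Id C (Cod C v')) \<boxplus> Id C (Cod C v')"
    by (simp add: plus_comm)
  then have "g \<odot> h = Id C (Cod C v')"
    by (rule plus_left_cancel) simp_all
  with hg show ?thesis by (intro exI[of _ g]) simp
qed

end

definition base_simplex :: "('o, 'm) tri \<Rightarrow> ('o, 'm) simplex" where
  "base_simplex A = \<lparr>pt = vtx A 0, arr = hor A 0\<rparr>"

lemma has_base_base_simplex: "has_base n A (base_simplex A)"
  by (simp add: has_base_def base_simplex_def)

lemma is_simplex_base_simplex: "is_tri C n A \<Longrightarrow> is_simplex C n (base_simplex A)"
  by (auto simp: is_simplex_def base_simplex_def Hom_def tri_ob tri_edges tri_comm)

context fully_triangulated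
begin

lemma D_tri: "\<lbrakk>n \<ge> 2; A \<in> D n\<rbrakk> \<Longrightarrow> is_tri C n A"
  using subcategory[of n] by (auto simp: is_subcategory_def Tri_def)

lemma M_map: "\<lbrakk>n \<ge> 2; (A, B, f) \<in> M n\<rbrakk> \<Longrightarrow> is_tri_map C n A B f"
  using subcategory[of n] by (auto simp: is_subcategory_def Tri_def)

lemma id_in_M: "\<lbrakk>n \<ge> 2; A \<in> D n\<rbrakk> \<Longrightarrow> \<exists>f. (A, A, f) \<in> M n"
  using subcategory[of n] by (auto simp: is_subcategory_def Tri_def)

lemma M_dom: "\<lbrakk>n \<ge> 2; (A, B, f) \<in> M n\<rbrakk> \<Longrightarrow> A \<in> D n"
  using subcategory[of n] by (fastforce simp: is_subcategory_def Tri_def)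

lemma face_D: "\<lbrakk>n > 2; m \<le> n; A \<in> D n\<rbrakk> \<Longrightarrow> face n m A \<in> D (n - 1)"
  using id_in_M[of n A] faces[of n m] M_dom[of "n - 1"] by (force simp: face_map_def)

lemma degen_D: "\<lbrakk>n > 2; m \<le> n - 1; A \<in> D (n - 1)\<rbrakk> \<Longrightarrow> degen C n m A \<in> D n"
  using id_in_M[of "n - 1" A] degeneracies[of n m] M_dom[of n] by (force simp: degen_map_def)

lemma ex_with_base_of:
  assumes "n \<ge> 2" "is_tri C n G"
  shows "\<exists>Y \<in> D n. (\<forall>j. 1 \<le> j \<and> j \<le> n \<longrightarrow> vtx Y 0 j = vtx G 0 j)
    \<and> (\<forall>j k. 1 \<le> j \<and> j < k \<and> k \<le> n \<longrightarrow> hor Y 0 j k = hor G 0 j k)"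
  using bases[OF assms(1) is_simplex_base_simplex[OF assms(2)]]
  by (auto simp: has_base_def base_simplex_def)

lemma extend_base_map:
  assumes "n \<ge> 2" "A \<in> D n" "B \<in> D n"
    and "\<And>j. \<lbrakk>1 \<le> j; j \<le> n\<rbrakk> \<Longrightarrow> g j \<in> Ar C \<and> Dom C (g j) = vtx A 0 j \<and> Cod C (g j) = vtx B 0 j"
    and "\<And>j k. \<lbrakk>1 \<le> j; j < k; k \<le> n\<rbrakk> \<Longrightarrow> g k \<odot> hor A 0 j k = hor B 0 j k \<odot> g j"
  obtains f where "is_tri_map C n A B f" "\<And>j. \<lbrakk>1 \<le> j; j \<le> n\<rbrakk> \<Longrightarrow> f 0 j = g j"
proof -
  have "is_simplex_map C n (base_simplex A) (base_simplex B) g"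
    using assms(4,5) by (auto simp: is_simplex_map_def base_simplex_def Hom_def)
  then obtain f where "(A, B, f) \<in> M n" "\<forall>j. 1 \<le> j \<and> j \<le> n \<longrightarrow> f 0 j = g j"
    using base_maps[OF assms(1) is_simplex_base_simplex[OF D_tri[OF assms(1,2)]]
      is_simplex_base_simplex[OF D_tri[OF assms(1,3)]] _ assms(2,3)
      has_base_base_simplex has_base_base_simplex] by blast
  with that M_map[OF assms(1)] show thesis by blast
qed

text \<open>Repeating the middle index places the zero object in the square with diagonal
  \<open>a\<^sub>0\<^sub>1 \<rightarrow> a\<^sub>1\<^sub>2\<close>.\<close>

lemma D2_comp_zero:
  assumes "T \<in> D 2"
  shows "ver T 0 1 2 \<odot> hor T 0 1 2 = Zero C (vtx T 0 1) (vtx T 1 2)"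
proof -
  have T: "is_tri C 2 T" using D_tri assms by simp
  have "is_tri C 3 (degen C 3 1 T)"
    using D_tri[of 3] degen_D[of 3 1 T] assms by simp
  from tri_comm(5)[OF this, of 0 1 2 3] show ?thesis
    using tri_ob[OF T, of 0 1] tri_ob[OF T, of 1 2]
    by (simp add: degen_def degen_vtx_def Let_def codegen_def)
qed

text \<open>The identity triangle is a face of a degeneracy: repeat the index \<open>1\<close> of any 2-triangle with
  \<open>a\<^sub>0\<^sub>1 = X\<close> and discard the last index, so that both copies remain.\<close>

lemma ex_identity_triangle:
  assumes "X \<in> Ob C"
  shows "\<exists>E \<in> D 2. vtx E 0 1 = X \<and> vtx E 0 2 = X \<and> vtx E 1 2 = zero_ob C
    \<and> hor E 0 1 2 = Id C X"
proof -
  have "is_simplex C 2 \<lparr>pt = \<lambda>_. X, arr = \<lambda>_ _. Id C X\<rparr>"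
    using assms by (auto simp: is_simplex_def Hom_def)
  then obtain T where T: "T \<in> D 2" "vtx T 0 1 = X"
    using bases[of 2 "\<lparr>pt = \<lambda>_. X, arr = \<lambda>_ _. Id C X\<rparr>"] by (auto simp: has_base_def)
  have "degen C 3 1 T \<in> D 3" using degen_D[of 3 1 T] T by simp
  then have "face 3 3 (degen C 3 1 T) \<in> D 2" using face_D[of 3 3] by simp
  then show ?thesis
    by (rule bexI[rotated])
      (use T in \<open>simp add: face_def coface_def degen_def degen_vtx_def Let_def codegen_def\<close>)
qed

lemma tau2_sel:
  "vtx (tau C 2 A) 0 (Suc 0) = vtx A 0 2" "vtx (tau C 2 A) 0 2 = vtx A 1 2"
  "vtx (tau C 2 A) (Suc 0) 2 = ShO C (vtx A 0 1)"
  "hor (tau C 2 A) 0 (Suc 0) 2 = ver A 0 1 2" "ver (tau C 2 A) 0 (Suc 0) 2 = dg1 A 0 1 2"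
  "dg1 (tau C 2 A) 0 (Suc 0) 2 = neg C (ShA C (hor A 0 1 2))"
  by (simp_all add: tau_def)

text \<open>If \<open>z : X \<rightarrow> b\<close> is killed by \<open>v\<close>, then \<open>(z, 0)\<close> maps the base \<open>X \<rightarrow> 0\<close> to the base \<open>b \<rightarrow> c\<close>.  These are
  the bases of the rotations of the identity triangle of \<open>X\<close> and of the given triangle, so the map
  extends; its third component is the shift of the required lift, because the signs that the
  rotation puts on the two degree-one edges cancel.\<close>

lemma D2_exact_second:
  assumes T: "T \<in> D 2"
  shows "hom_exact C (hor T 0 1 2) (ver T 0 1 2)"
proof -
  note T' = D_tri[OF _ T, simplified]
  note [simp] = tri_ob[OF T'] tri_edges[OF T']
  have "\<exists>t \<in> Ar C. Dom C t = Dom C z \<and> Cod C t = vtx T 0 1 \<and> z = hor T 0 1 2 \<odot> t"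
    if z: "z \<in> Ar C" "Cod C z = vtx T 0 2" and 0: "ver T 0 1 2 \<odot> z = Zero C (Dom C z) (vtx T 1 2)"
    for z
  proof -
    define X where "X = Dom C z"
    have X [simp]: "X \<in> Ob C" using z by (simp add: X_def)
    obtain E where E: "E \<in> D 2" "vtx E 0 1 = X" "vtx E 0 2 = X" "vtx E 1 2 = zero_ob C"
      "hor E 0 1 2 = Id C X"
      using ex_identity_triangle[OF X] by blast
    note E' = D_tri[OF _ E(1), simplified]
    have vE: "ver E 0 1 2 = Zero C X (zero_ob C)"
      using into_zero_object[OF id_zero_ob, of "ver E 0 1 2"] tri_edges[OF E', of 0 1 2] E by simp
    define g where "g j = (if j = 1 then z else Zero C (zero_ob C) (vtx T 1 2))" for j :: nat
    obtain f where f: "is_tri_map C 2 (tau C 2 E) (tau C 2 T) f"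
      "\<And>j. \<lbrakk>1 \<le> j; j \<le> 2\<rbrakk> \<Longrightarrow> f 0 j = g j"
    proof (rule extend_base_map[of 2 "tau C 2 E" "tau C 2 T" g])
      show "g j \<in> Ar C \<and> Dom C (g j) = vtx (tau C 2 E) 0 j \<and> Cod C (g j) = vtx (tau C 2 T) 0 j"
        if "1 \<le> j" "j \<le> 2" for j
      proof -
        from that have "j = 1 \<or> j = 2" by auto
        then show ?thesis using z E X by (auto simp: g_def tau2_sel X_def)
      qed
      show "g k \<odot> hor (tau C 2 E) 0 j k = hor (tau C 2 T) 0 j k \<odot> g j"
        if "1 \<le> j" "j < k" "k \<le> 2" for j k
      proof -
        from that have "j = 1" "k = 2" by auto
        then show ?thesis using z 0 by (simp add: g_def tau2_sel vE[simplified] X_def)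
      qed
    qed (use T E rotation_tau in auto)
    have f12 [simp]: "f 1 2 \<in> Ar C" "Dom C (f 1 2) = ShO C X" "Cod C (f 1 2) = ShO C (vtx T 0 1)"
      using tri_map_ar[OF f(1), of 1 2] E by (auto simp: tau2_sel)
    then obtain t where t: "t \<in> Ar C" "Dom C t = X" "Cod C t = vtx T 0 1" "f 1 2 = ShA C t"
      by (rule sh_full) auto
    have ht: "hor T 0 1 2 \<odot> t \<in> Ar C" using t by simp
    have "ShA C z \<odot> neg C (Id C (ShO C X)) = neg C (ShA C (hor T 0 1 2)) \<odot> ShA C t"
      using tri_map_comm(3)[OF f(1), of 0 1 2] f(2)[of 1] E t
      by (simp add: tau2_sel g_def shift_id)
    then have "neg C (ShA C z) = neg C (ShA C (hor T 0 1 2 \<odot> t))"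
      using t z by (simp add: comp_neg neg_comp sh_comp X_def)
    then have "ShA C z = ShA C (hor T 0 1 2 \<odot> t)"
      using neg_neg[OF sh_ar[OF z(1)]] neg_neg[OF sh_ar[OF ht]] by metis
    then have "z = hor T 0 1 2 \<odot> t"
      using sh_inj z(1) ht by blast
    then show ?thesis using t by (auto simp: X_def)
  qed
  then show ?thesis using D2_comp_zero[OF T] by (simp add: hom_exact_def)
qed

text \<open>The other two places follow by rotation; the sign introduced by \<open>tau\<close> does not change kernels.\<close>

lemma D2_exact:
  assumes T: "T \<in> D 2"
  shows "face_exact C T 1 2"
proof -
  note [simp] = tri_ob[OF D_tri[OF _ T, simplified]] tri_edges[OF D_tri[OF _ T, simplified]]
  have T': "tau C 2 T \<in> D 2" "tau C 2 (tau C 2 T) \<in> D 2" using rotation_tau T by auto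
  have "hom_exact C (dg1 T 0 1 2) (neg C (ShA C (hor T 0 1 2)))"
    using D2_exact_second[OF T'(2)] by (simp add: tau2_sel)
  then have "hom_exact C (dg1 T 0 1 2) (ShA C (hor T 0 1 2))"
    by (rule hom_exact_neg_right) auto
  then show ?thesis using D2_exact_second[OF T] D2_exact_second[OF T'(1)]
    by (simp add: face_exact_def tau2_sel)
qed

text \<open>Faces are available one index at a time, hence the induction: as long as \<open>n > 2\<close> there is an index
  \<open>m\<close> other than \<open>0\<close>, \<open>i\<close>, \<open>j\<close> to be discarded.\<close>

lemma D_exact:
  assumes "n \<ge> 2" "A \<in> D n" "0 < i" "i < j" "j \<le> n"
  shows "face_exact C A i j"
  using assms
proof (induction n arbitrary: A i j rule: nat_induct_at_least[where m = 2])
  case base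
  then have "i = 1" "j = 2" by auto
  with D2_exact[OF base(1)] show ?case by simp
next
  case (Suc n)
  have "card {0, i, j} < card {0..Suc n}" using Suc by (simp add: card_insert_if)
  then have "\<not> {0..Suc n} \<subseteq> {0, i, j}" using card_mono[of "{0, i, j}" "{0..Suc n}"] by auto
  then obtain m where "m \<in> {0..Suc n}" "m \<notin> {0, i, j}" by blast
  then have m: "m \<le> Suc n" "m \<noteq> 0" "m \<noteq> i" "m \<noteq> j" by auto
  define d where "d k = (if k < m then k else k - 1)" for k
  have cd: "coface m 0 = 0" "coface m (d i) = i" "coface m (d j) = j"
    and lt: "0 < d i" "d i < d j" "d j \<le> n"
    using m Suc.prems by (auto simp: coface_def d_def)
  have "face (Suc n) m A \<in> D n" using face_D[of "Suc n" m A] Suc m by simp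
  from Suc.IH[OF this lt] show ?case
    using lt by (simp add: face_exact_def face_def Let_def cd)
qed

text \<open>The criterion by which diagrams are shown to be distinguished.  By the five lemma, applied to the
  2-triangles on \<open>0\<close>, \<open>i\<close>, \<open>j\<close>, the given map is an isomorphism at every \<open>a\<^sub>i\<^sub>j\<close>; so \<open>G\<close> is isomorphic to \<open>Y\<close>.
  The map itself is not required to be distinguished, and it can be put together from pieces of
  distinguished maps.\<close>

lemma D_recognition:
  assumes n: "n \<ge> 2" and Y: "Y \<in> D n" and G: "is_tri C n G"
    and f: "is_tri_map C n Y G f"
    and id: "\<And>j. \<lbrakk>1 \<le> j; j \<le> n\<rbrakk> \<Longrightarrow> vtx Y 0 j = vtx G 0 j \<and> f 0 j = Id C (vtx G 0 j)"
    and ex: "\<And>i j. \<lbrakk>0 < i; i < j; j \<le> n\<rbrakk> \<Longrightarrow> face_exact C G i j"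
  shows "G \<in> D n"
proof -
  have Y': "is_tri C n Y" using D_tri n Y by simp
  note [simp] = tri_edges[OF Y'] tri_edges[OF G] tri_ob[OF Y'] tri_ob[OF G] tri_map_ar[OF f]
  have "is_iso (Tri C n) (Y, G, f)"
  proof (rule tri_map_is_iso[OF Y' G f])
    fix i j :: nat assume ij: "i < j" "j \<le> n"
    show "\<exists>g. g \<in> Ar C \<and> Dom C g = vtx G i j \<and> Cod C g = vtx Y i j
      \<and> g \<odot> f i j = Id C (vtx Y i j) \<and> f i j \<odot> g = Id C (vtx G i j)"
    proof (cases "i = 0")
      case True
      then show ?thesis using ij id[of j] by (intro exI[of _ "Id C (vtx G 0 j)"]) auto
    next
      case False
      then have i: "0 < i" "i \<le> n" using ij by auto
      have eq: "hor G 0 i j = hor Y 0 i j" "f i j \<odot> ver Y 0 i j = ver G 0 i j"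
        "dg1 G 0 i j \<odot> f i j = dg1 Y 0 i j"
        using tri_map_comm[OF f i(1) ij] id[of i] id[of j] i ij by (simp_all add: shift_id)
      have "\<exists>g. g \<in> Ar C \<and> Dom C g = Cod C (f i j) \<and> Cod C g = Dom C (f i j)
        \<and> g \<odot> f i j = Id C (Dom C (f i j)) \<and> f i j \<odot> g = Id C (Cod C (f i j))"
        by (rule five_lemma[of "hor G 0 i j" "ver G 0 i j" "dg1 G 0 i j" "ShA C (hor G 0 i j)"
          "ver Y 0 i j" "dg1 Y 0 i j"])
         (use i ij id[of i] id[of j] eq ex[OF i(1) ij] D_exact[OF n Y i(1) ij] in
           \<open>auto simp: face_exact_def\<close>)
      then show ?thesis using ij by simp
    qed
  qed
  from iso_ob[OF n this] Y show ?thesis by (simp add: Tri_def)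
qed

end

section \<open>Appending a zero object to the base\<close>

text \<open>The diagram whose base is that of \<open>B\<close> followed by \<open>0\<close>.  The third vertex of a triangle on
  \<open>b\<^sub>0\<^sub>i \<rightarrow> 0\<close> is \<open>b\<^sub>0\<^sub>i[1]\<close>, and the new edges are forced by the identity as edge \<open>b\<^sub>0\<^sub>i[1] \<rightarrow> b\<^sub>0\<^sub>i[1]\<close> of
  degree one.  Its rotation by \<open>tau\<close> is the degeneracy of \<open>sigma\<close> of \<open>B\<close> that repeats the index \<open>0\<close>.\<close>

definition append_zero :: "('o, 'm, 'z) shift_cat_scheme \<Rightarrow> nat \<Rightarrow> ('o, 'm) tri \<Rightarrow> ('o, 'm) tri" where
  "append_zero C n B = restr_tri (Suc n)
    \<lparr>vtx = (\<lambda>i j. if j \<le> n then vtx B i j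
                  else if i = 0 then zero_ob C else ShO C (vtx B 0 i)),
     hor = (\<lambda>i j k. if k \<le> n then hor B i j k
                    else if i = 0 then Zero C (vtx B 0 j) (zero_ob C) else dg1 B 0 i j),
     ver = (\<lambda>i j k. if k \<le> n then ver B i j k
                    else if i = 0 then Zero C (zero_ob C) (ShO C (vtx B 0 j))
                    else ShA C (hor B 0 i j)),
     dg1 = (\<lambda>i j k. if k \<le> n then dg1 B i j k
                    else if i = 0 then Id C (ShO C (vtx B 0 j)) else ShA C (ver B 0 i j))\<rparr>"

context additive_category
begin

lemma hom_exact_trivial:
  assumes z: "z \<in> Ob C" "Id C z = Zero C z z" and xy: "x \<in> Ob C" "y \<in> Ob C"
  shows "hom_exact C (Zero C x z) (Zero C z y)" "hom_exact C (Zero C z y) (Id C y)"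
    "hom_exact C (Id C x) (Zero C x y)"
proof -
  show "hom_exact C (Zero C x z) (Zero C z y)"
    unfolding hom_exact_def
  proof (intro conjI ballI impI)
    fix t assume t: "t \<in> Ar C" "Cod C t = Dom C (Zero C z y) \<and>
      Zero C z y \<odot> t = Zero C (Dom C t) (Cod C (Zero C z y))"
    then show "\<exists>s \<in> Ar C. Dom C s = Dom C t \<and> Cod C s = Dom C (Zero C x z) \<and> t = Zero C x z \<odot> s"
      using into_zero_object[OF z(2), of t] xy z(1)
      by (intro bexI[of _ "Zero C (Dom C t) x"]) simp_all
  qed (use z(1) xy in simp)
  show "hom_exact C (Zero C z y) (Id C y)"
    unfolding hom_exact_def
  proof (intro conjI ballI impI)
    fix t assume t: "t \<in> Ar C"
      "Cod C t = Dom C (Id C y) \<and> Id C y \<odot> t = Zero C (Dom C t) (Cod C (Id C y))"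
    then have "t = Zero C (Dom C t) y" using xy(2) comp_id_left cod_id dom_id by metis
    moreover have "Zero C z y \<odot> Zero C (Dom C t) z = Zero C (Dom C t) y" using t(1) z(1) xy by simp
    moreover have "Zero C (Dom C t) z \<in> Ar C" "Dom C (Zero C (Dom C t) z) = Dom C t"
      "Cod C (Zero C (Dom C t) z) = Dom C (Zero C z y)" using t(1) z(1) xy by simp_all
    ultimately show "\<exists>s \<in> Ar C. Dom C s = Dom C t \<and> Cod C s = Dom C (Zero C z y) \<and> t = Zero C z y \<odot> s"
      by metis
  qed (use z(1) xy in simp)
  show "hom_exact C (Id C x) (Zero C x y)"
    unfolding hom_exact_def
  proof (intro conjI ballI impI)
    fix t assume "t \<in> Ar C" "Cod C t = Dom C (Zero C x y) \<and>
      Zero C x y \<odot> t = Zero C (Dom C t) (Cod C (Zero C x y))"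
    then show "\<exists>s \<in> Ar C. Dom C s = Dom C t \<and> Cod C s = Dom C (Id C x) \<and> t = Id C x \<odot> s"
      using xy by (intro bexI[of _ t]) simp_all
  qed (use xy in simp)
qed

end

context additive_shift_category
begin

text \<open>The squares of the diagram that pass through the new zero object commute because the composite
  \<open>b\<^sub>0\<^sub>k \<rightarrow> b\<^sub>j\<^sub>k \<rightarrow> b\<^sub>0\<^sub>j[1]\<close> vanishes.\<close>

lemma append_zero_is_tri:
  assumes B: "is_tri C n B"
    and zero: "\<And>j k. \<lbrakk>0 < j; j < k; k \<le> n\<rbrakk>
      \<Longrightarrow> dg1 B 0 j k \<odot> ver B 0 j k = Zero C (vtx B 0 k) (ShO C (vtx B 0 j))"
  shows "is_tri C (Suc n) (append_zero C n B)"
proof -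
  note [simp] = tri_ob[OF B] tri_edges[OF B]
  show ?thesis
    unfolding is_tri_def append_zero_def
  proof (intro conjI allI impI, goal_cases)
    case (2 i j)
    then show ?case by auto
  next
    case (3 i j k)
    then show ?case by (auto simp: Hom_def)
  next
    case (4 i j k)
    then show ?case by (auto simp: Hom_def)
  next
    case (5 i j k)
    then show ?case by (auto simp: Hom_def)
  next
    case (6 i j k l)
    then show ?case using tri_comm(1,2)[OF B] by auto
  next
    case (7 i j k l)
    then show ?case using tri_comm(2,3)[OF B] by auto
  next
    case (8 i j k l)
    then show ?case using tri_comm(3,4)[OF B] by (auto simp flip: sh_comp)
  next
    case (9 i j k l)
    then show ?case using tri_comm(1,4)[OF B] by (auto simp flip: sh_comp)
  next
    case (10 i j k l)
    then show ?case using tri_comm(5,6)[OF B] zero by auto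
  next
    case (11 i j k l)
    then show ?case using tri_comm(5,6)[OF B] by (auto simp flip: sh_comp)
  qed simp
qed

end

context fully_triangulated
begin

text \<open>Take a distinguished \<open>Y\<close> with the same base.  Its last face has the base of \<open>B\<close>, so there is a map from
  this face to \<open>B\<close>; at the new vertices it is continued by the degree-one edges
  \<open>y\<^sub>i\<^sub>,\<^sub>n\<^sub>+\<^sub>1 \<rightarrow> y\<^sub>0\<^sub>i[1] = b\<^sub>0\<^sub>i[1]\<close>.\<close>

lemma append_zero_D:
  assumes n: "n \<ge> 2" and B: "B \<in> D n"
  shows "append_zero C n B \<in> D (Suc n)"
proof -
  note B' = D_tri[OF n B]
  define G where "G = append_zero C n B"
  have G: "is_tri C (Suc n) G"
    unfolding G_def
  proof (rule append_zero_is_tri[OF B'])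
    fix j k assume jk: "0 < j" "j < k" "k \<le> n"
    then have ex: "hom_exact C (ver B 0 j k) (dg1 B 0 j k)"
      using D_exact[OF n B] by (simp add: face_exact_def)
    show "dg1 B 0 j k \<odot> ver B 0 j k = Zero C (vtx B 0 k) (ShO C (vtx B 0 j))"
      using hom_exactD(1)[OF ex] jk tri_edges[OF B', of 0 j k] by simp
  qed
  obtain Y where Y: "Y \<in> D (Suc n)"
    and vY: "\<And>j. \<lbrakk>1 \<le> j; j \<le> Suc n\<rbrakk> \<Longrightarrow> vtx Y 0 j = vtx G 0 j"
    and hY: "\<And>j k. \<lbrakk>1 \<le> j; j < k; k \<le> Suc n\<rbrakk> \<Longrightarrow> hor Y 0 j k = hor G 0 j k"
    using ex_with_base_of[OF _ G] n by auto
  have n': "Suc n \<ge> 2" using n by simp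
  note Y' = D_tri[OF n' Y]
  note [simp] = tri_ob[OF B'] tri_edges[OF B'] tri_ob[OF Y'] tri_edges[OF Y']
  have sel [simp]:
    "\<And>i j. \<lbrakk>i < j; j \<le> n\<rbrakk> \<Longrightarrow> vtx G i j = vtx B i j"
    "vtx G 0 (Suc n) = zero_ob C"
    "\<And>i. \<lbrakk>0 < i; i \<le> n\<rbrakk> \<Longrightarrow> vtx G i (Suc n) = ShO C (vtx B 0 i)"
    "\<And>i j k. \<lbrakk>i < j; j < k; k \<le> n\<rbrakk> \<Longrightarrow> hor G i j k = hor B i j k"
    "\<And>j. \<lbrakk>0 < j; j \<le> n\<rbrakk> \<Longrightarrow> hor G 0 j (Suc n) = Zero C (vtx B 0 j) (zero_ob C)"
    "\<And>i j. \<lbrakk>0 < i; i < j; j \<le> n\<rbrakk> \<Longrightarrow> hor G i j (Suc n) = dg1 B 0 i j"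
    "\<And>i j k. \<lbrakk>i < j; j < k; k \<le> n\<rbrakk> \<Longrightarrow> ver G i j k = ver B i j k"
    "\<And>j. \<lbrakk>0 < j; j \<le> n\<rbrakk> \<Longrightarrow> ver G 0 j (Suc n) = Zero C (zero_ob C) (ShO C (vtx B 0 j))"
    "\<And>i j. \<lbrakk>0 < i; i < j; j \<le> n\<rbrakk> \<Longrightarrow> ver G i j (Suc n) = ShA C (hor B 0 i j)"
    "\<And>i j k. \<lbrakk>i < j; j < k; k \<le> n\<rbrakk> \<Longrightarrow> dg1 G i j k = dg1 B i j k"
    "\<And>j. \<lbrakk>0 < j; j \<le> n\<rbrakk> \<Longrightarrow> dg1 G 0 j (Suc n) = Id C (ShO C (vtx B 0 j))"
    "\<And>i j. \<lbrakk>0 < i; i < j; j \<le> n\<rbrakk> \<Longrightarrow> dg1 G i j (Suc n) = ShA C (ver B 0 i j)"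
    by (auto simp: G_def append_zero_def)
  have vY' [simp]: "\<And>j. \<lbrakk>0 < j; j \<le> n\<rbrakk> \<Longrightarrow> vtx Y 0 j = vtx B 0 j" "vtx Y 0 (Suc n) = zero_ob C"
    and hY' [simp]: "\<And>j k. \<lbrakk>0 < j; j < k; k \<le> n\<rbrakk> \<Longrightarrow> hor Y 0 j k = hor B 0 j k"
    "\<And>j. \<lbrakk>0 < j; j \<le> n\<rbrakk> \<Longrightarrow> hor Y 0 j (Suc n) = Zero C (vtx B 0 j) (zero_ob C)"
    using vY hY by auto
  define F where "F = face (Suc n) (Suc n) Y"
  have F [simp]:
    "\<And>i j. \<lbrakk>i < j; j \<le> n\<rbrakk> \<Longrightarrow> vtx F i j = vtx Y i j"
    "\<And>i j k. \<lbrakk>i < j; j < k; k \<le> n\<rbrakk> \<Longrightarrow> hor F i j k = hor Y i j k"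
    "\<And>i j k. \<lbrakk>i < j; j < k; k \<le> n\<rbrakk> \<Longrightarrow> ver F i j k = ver Y i j k"
    "\<And>i j k. \<lbrakk>i < j; j < k; k \<le> n\<rbrakk> \<Longrightarrow> dg1 F i j k = dg1 Y i j k"
    by (simp_all add: F_def face_def Let_def coface_def)
  have "F \<in> D n" using face_D[OF _ _ Y] n by (simp add: F_def)
  then obtain f where f: "is_tri_map C n F B f"
    and f0 [simp]: "\<And>j. \<lbrakk>1 \<le> j; j \<le> n\<rbrakk> \<Longrightarrow> f 0 j = Id C (vtx B 0 j)"
    by (rule extend_base_map[OF n _ B, of F "\<lambda>j. Id C (vtx B 0 j)"]) auto
  have f_ar [simp]: "\<And>i j. \<lbrakk>i < j; j \<le> n\<rbrakk> \<Longrightarrow> f i j \<in> Ar C"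
    "\<And>i j. \<lbrakk>i < j; j \<le> n\<rbrakk> \<Longrightarrow> Dom C (f i j) = vtx Y i j"
    "\<And>i j. \<lbrakk>i < j; j \<le> n\<rbrakk> \<Longrightarrow> Cod C (f i j) = vtx B i j"
    using tri_map_ar[OF f] by auto
  define g where "g i j = (if j \<le> n then f i j
    else if i = 0 then Id C (zero_ob C) else dg1 Y 0 i (Suc n))" for i j
  have "is_tri_map C (Suc n) Y G (restr2 (Suc n) g)"
    unfolding is_tri_map_def
  proof (intro conjI allI impI, goal_cases)
    case (2 i j)
    then consider "j \<le> n" | "j = Suc n" "i = 0" | "j = Suc n" "0 < i" by linarith
    then show ?case using 2 by cases (auto simp: g_def Hom_def)
  next
    case (3 i j k)
    then consider "k \<le> n" | "k = Suc n" "i = 0" | "k = Suc n" "0 < i" by linarith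
    then show ?case
    proof cases
      case 1
      then show ?thesis using 3 tri_map_comm(1)[OF f, of i j k] by (simp add: g_def)
    next
      case 2
      then show ?thesis using 3 by (simp add: g_def)
    next
      case 3
      with \<open>i < j \<and> j < k \<and> k \<le> Suc n\<close> show ?thesis
        using tri_map_comm(3)[OF f, of 0 i j] tri_comm(2)[OF Y', of 0 i j "Suc n"]
        by (simp add: g_def shift_id)
    qed
  next
    case (4 i j k)
    then consider "k \<le> n" | "k = Suc n" "i = 0" | "k = Suc n" "0 < i" by linarith
    then show ?case
    proof cases
      case 1
      then show ?thesis using 4 tri_map_comm(2)[OF f, of i j k] by (simp add: g_def)
    next
      case 2
      then show ?thesis
        using 4 from_zero_object[OF id_zero_ob, of "dg1 Y 0 j (Suc n) \<odot> ver Y 0 j (Suc n)"]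
        by (simp add: g_def)
    next
      case 3
      with \<open>i < j \<and> j < k \<and> k \<le> Suc n\<close> show ?thesis
        using tri_comm(6)[OF Y', of 0 i j "Suc n"] by (simp add: g_def)
    qed
  next
    case (5 i j k)
    then consider "k \<le> n" | "k = Suc n" "i = 0" | "k = Suc n" "0 < i" by linarith
    then show ?case
    proof cases
      case 1
      then show ?thesis using 5 tri_map_comm(3)[OF f, of i j k] by (simp add: g_def)
    next
      case 2
      then show ?thesis using 5 by (simp add: g_def shift_id)
    next
      case 3
      with 5 have l: "0 < i" "i < j" "j \<le> n" by auto
      have "ShA C (f i j) \<odot> dg1 Y i j (Suc n)
          = ShA C (f i j) \<odot> (ShA C (ver Y 0 i j) \<odot> dg1 Y 0 j (Suc n))"
        using tri_comm(3)[OF Y', of 0 i j "Suc n"] l by simp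
      also have "\<dots> = ShA C (f i j \<odot> ver Y 0 i j) \<odot> dg1 Y 0 j (Suc n)"
        using l by (simp add: sh_comp comp_assoc)
      also have "\<dots> = ShA C (ver B 0 i j) \<odot> dg1 Y 0 j (Suc n)"
        using tri_map_comm(2)[OF f, of 0 i j] l by simp
      finally show ?thesis using l 3 by (simp add: g_def)
    qed
  qed simp
  then have "G \<in> D (Suc n)"
  proof (rule D_recognition[OF n' Y G])
    show "vtx Y 0 j = vtx G 0 j \<and> restr2 (Suc n) g 0 j = Id C (vtx G 0 j)"
      if "1 \<le> j" "j \<le> Suc n" for j
    proof (cases "j = Suc n")
      case False
      then show ?thesis using that by (simp add: g_def)
    qed (simp add: g_def)
    show "face_exact C G i j" if "0 < i" "i < j" "j \<le> Suc n" for i j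
    proof (cases "j = Suc n")
      case False
      then show ?thesis using that D_exact[OF n B, of i j] by (simp add: face_exact_def)
    next
      case True
      with that have i: "0 < i" "i \<le> n" by auto
      then show ?thesis unfolding True
        using hom_exact_trivial[OF zero_ob_ob id_zero_ob, of "vtx B 0 i" "ShO C (vtx B 0 i)"]
          hom_exact_trivial(3)[OF zero_ob_ob id_zero_ob, of "ShO C (vtx B 0 i)" "ShO C (zero_ob C)"]
        by (simp add: face_exact_def)
    qed
  qed
  then show ?thesis by (simp add: G_def)
qed

end

section \<open>Direct sums of distinguished diagrams\<close>

definition dsum_tri :: "('o, 'm, 'z) shift_cat_scheme \<Rightarrow> nat \<Rightarrow> (nat \<Rightarrow> nat \<Rightarrow> ('o, 'm) biprod)
    \<Rightarrow> ('o, 'm) tri \<Rightarrow> ('o, 'm) tri \<Rightarrow> ('o, 'm) tri" where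
  "dsum_tri C n P A B = restr_tri n
    \<lparr>vtx = (\<lambda>i j. Sm (P i j)),
     hor = (\<lambda>i j k. dsum_map C (P i j) (P i k) (hor A i j k) (hor B i j k)),
     ver = (\<lambda>i j k. dsum_map C (P i k) (P j k) (ver A i j k) (ver B i j k)),
     dg1 = (\<lambda>i j k. dsum_map C (P j k) (shift_biprod C (P i j)) (dg1 A i j k) (dg1 B i j k))\<rparr>"

lemma shift_biprod_sel [simp]:
  "Sm (shift_biprod C B) = ShO C (Sm B)"
  "in1 (shift_biprod C B) = ShA C (in1 B)" "in2 (shift_biprod C B) = ShA C (in2 B)"
  "pr1 (shift_biprod C B) = ShA C (pr1 B)" "pr2 (shift_biprod C B) = ShA C (pr2 B)"
  by (simp_all add: shift_biprod_def)

context additive_shift_category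
begin

lemma dsum_exact:
  assumes P: "is_biprod C x y P" and Q: "is_biprod C x' y' Q" and R: "is_biprod C x'' y'' R"
    and f: "f \<in> Ar C" "g \<in> Ar C" "Dom C f = x" "Cod C f = x'" "Dom C g = y" "Cod C g = y'"
    and f': "f' \<in> Ar C" "g' \<in> Ar C" "Dom C f' = x'" "Cod C f' = x''" "Dom C g' = y'" "Cod C g' = y''"
    and ex: "hom_exact C f f'" "hom_exact C g g'"
  shows "hom_exact C (dsum_map C P Q f g) (dsum_map C Q R f' g')"
proof -
  note [simp] = biprodD[OF P] biprodD[OF Q] biprodD[OF R] dsum_ar[OF P Q f] dsum_ar[OF Q R f'] f f'
  have "dsum_map C Q R f' g' \<odot> dsum_map C P Q f g = Zero C (Sm P) (Sm R)"
    using hom_exactD(1)[OF ex(1)] hom_exactD(1)[OF ex(2)]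
    by (simp add: dsum_comp[OF P Q R f f']) (simp add: dsum_map_def)
  moreover have "\<exists>t \<in> Ar C. Dom C t = Dom C z \<and> Cod C t = Sm P \<and> z = dsum_map C P Q f g \<odot> t"
    if z: "z \<in> Ar C" "Cod C z = Sm Q" and 0: "dsum_map C Q R f' g' \<odot> z = Zero C (Dom C z) (Sm R)" for z
  proof -
    have "f' \<odot> (pr1 Q \<odot> z) = pr1 R \<odot> (dsum_map C Q R f' g' \<odot> z)"
      "g' \<odot> (pr2 Q \<odot> z) = pr2 R \<odot> (dsum_map C Q R f' g' \<odot> z)"
      using z comp_assoc[of z "pr1 Q" f'] comp_assoc[of z "dsum_map C Q R f' g'" "pr1 R"]
        comp_assoc[of z "pr2 Q" g'] comp_assoc[of z "dsum_map C Q R f' g'" "pr2 R"] by simp_all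
    then have "f' \<odot> (pr1 Q \<odot> z) = Zero C (Dom C z) x''" "g' \<odot> (pr2 Q \<odot> z) = Zero C (Dom C z) y''"
      using 0 z by simp_all
    then obtain s t where s: "s \<in> Ar C" "Dom C s = Dom C z" "Cod C s = x" "pr1 Q \<odot> z = f \<odot> s"
      and t: "t \<in> Ar C" "Dom C t = Dom C z" "Cod C t = y" "pr2 Q \<odot> z = g \<odot> t"
      using hom_exactD(2)[OF ex(1), of "pr1 Q \<odot> z"] hom_exactD(2)[OF ex(2), of "pr2 Q \<odot> z"] z
      by auto
    note [simp] = pair_into_ar[OF P, of s t]
    have eq: "pr1 Q \<odot> (dsum_map C P Q f g \<odot> pair_into C P s t) = f \<odot> s"
      "pr2 Q \<odot> (dsum_map C P Q f g \<odot> pair_into C P s t) = g \<odot> t"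
      using s(1-3) t(1-3) comp_assoc[of "pair_into C P s t" "pr1 P" f]
        comp_assoc[of "pair_into C P s t" "dsum_map C P Q f g" "pr1 Q"]
        comp_assoc[of "pair_into C P s t" "pr2 P" g]
        comp_assoc[of "pair_into C P s t" "dsum_map C P Q f g" "pr2 Q"] by simp_all
    have "z = dsum_map C P Q f g \<odot> pair_into C P s t"
      by (rule biprod_ext[OF Q]) (simp_all add: z s t eq)
    moreover have "pair_into C P s t \<in> Ar C" "Dom C (pair_into C P s t) = Dom C z"
      "Cod C (pair_into C P s t) = Sm P"
      using s(1-3) t(1-3) by simp_all
    ultimately show ?thesis by blast
  qed
  ultimately show ?thesis by (simp add: hom_exact_def)
qed

lemma dsum_tri_is_tri:
  assumes A: "is_tri C n A" and B: "is_tri C n B"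
    and P: "\<And>i j. \<lbrakk>i < j; j \<le> n\<rbrakk> \<Longrightarrow> is_biprod C (vtx A i j) (vtx B i j) (P i j)"
  shows "is_tri C n (dsum_tri C n P A B)"
proof -
  note [simp] = tri_edges[OF A] tri_edges[OF B]
  note P' = is_biprod_shift[OF P]
  show ?thesis
    unfolding is_tri_def dsum_tri_def
  proof (intro conjI allI impI, goal_cases)
    case (2 i j)
    then show ?case using biprodD(1)[OF P, of i j] by simp
  next
    case (3 i j k)
    then have l: "i < j" "j < k" "i < k" "j \<le> n" "k \<le> n" by auto
    then show ?case
      using dsum_ar[OF P[of i j] P[of i k], of "hor A i j k" "hor B i j k"] by (simp add: Hom_def)
  next
    case (4 i j k)
    then have l: "i < j" "j < k" "i < k" "j \<le> n" "k \<le> n" by auto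
    then show ?case
      using dsum_ar[OF P[of i k] P[of j k], of "ver A i j k" "ver B i j k"] by (simp add: Hom_def)
  next
    case (5 i j k)
    then have l: "i < j" "j < k" "i < k" "j \<le> n" "k \<le> n" by auto
    then show ?case
      using dsum_ar[OF P[of j k] P'[of i j], of "dg1 A i j k" "dg1 B i j k"] by (simp add: Hom_def)
  next
    case (6 i j k l)
    then have "i < j" "j < k" "k < l" "i < k" "i < l" "j < l" "j \<le> n" "k \<le> n" "l \<le> n" by auto
    then show ?case
      by (simp add: dsum_comp[OF P[of i j] P[of i k] P[of i l]] tri_comm[OF A] tri_comm[OF B])
  next
    case (7 i j k l)
    then have "i < j" "j < k" "k < l" "i < k" "i < l" "j < l" "j \<le> n" "k \<le> n" "l \<le> n" by auto
    then show ?case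
      by (simp add: dsum_comp[OF P[of j k] P[of j l] P'[of i j]] tri_comm[OF A] tri_comm[OF B])
  next
    case (8 i j k l)
    then have "i < j" "j < k" "k < l" "i < k" "i < l" "j < l" "j \<le> n" "k \<le> n" "l \<le> n" by auto
    then show ?case
      by (simp add: shift_dsum[OF P[of i k] P[of j k]]
        dsum_comp[OF P[of k l] P'[of i k] P'[of j k]] tri_comm[OF A] tri_comm[OF B])
  next
    case (9 i j k l)
    then have "i < j" "j < k" "k < l" "i < k" "i < l" "j < l" "j \<le> n" "k \<le> n" "l \<le> n" by auto
    then show ?case
      by (simp add: dsum_comp[OF P[of i l] P[of j l] P[of k l]] tri_comm[OF A] tri_comm[OF B])
  next
    case (10 i j k l)
    then have "i < j" "j < k" "k < l" "i < k" "i < l" "j < l" "j \<le> n" "k \<le> n" "l \<le> n" by auto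
    then show ?case
      by (simp add: dsum_comp[OF P[of i k] P[of i l] P[of j l]]
        dsum_comp[OF P[of i k] P[of j k] P[of j l]] tri_comm[OF A] tri_comm[OF B])
  next
    case (11 i j k l)
    then have "i < j" "j < k" "k < l" "i < k" "i < l" "j < l" "j \<le> n" "k \<le> n" "l \<le> n" by auto
    then show ?case
      by (simp add: dsum_comp[OF P[of j l] P[of k l] P'[of i k]] shift_dsum[OF P[of i j] P[of i k]]
        dsum_comp[OF P[of j l] P'[of i j] P'[of i k]] tri_comm[OF A] tri_comm[OF B])
  qed simp
qed

end

context fully_triangulated
begin

text \<open>Take a distinguished \<open>Y\<close> on the direct sum of the two bases.  The projections of the bases extend to
  distinguished maps from \<open>Y\<close> to \<open>A\<close> and to \<open>B\<close>, and these are the components of a map from \<open>Y\<close> to the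
  direct sum which is the identity on the base.\<close>

lemma dsum_tri_D:
  assumes n: "n \<ge> 2" and A: "A \<in> D n" and B: "B \<in> D n"
    and P: "\<And>i j. \<lbrakk>i < j; j \<le> n\<rbrakk> \<Longrightarrow> is_biprod C (vtx A i j) (vtx B i j) (P i j)"
  shows "dsum_tri C n P A B \<in> D n"
proof -
  define G where "G = dsum_tri C n P A B"
  note A' = D_tri[OF n A] and B' = D_tri[OF n B] and P' = is_biprod_shift[OF P]
  have G: "is_tri C n G" unfolding G_def by (rule dsum_tri_is_tri[OF A' B' P])
  have sel [simp]:
    "\<And>i j. \<lbrakk>i < j; j \<le> n\<rbrakk> \<Longrightarrow> vtx G i j = Sm (P i j)"
    "\<And>i j k. \<lbrakk>i < j; j < k; k \<le> n\<rbrakk>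
      \<Longrightarrow> hor G i j k = dsum_map C (P i j) (P i k) (hor A i j k) (hor B i j k)"
    "\<And>i j k. \<lbrakk>i < j; j < k; k \<le> n\<rbrakk>
      \<Longrightarrow> ver G i j k = dsum_map C (P i k) (P j k) (ver A i j k) (ver B i j k)"
    "\<And>i j k. \<lbrakk>i < j; j < k; k \<le> n\<rbrakk>
      \<Longrightarrow> dg1 G i j k = dsum_map C (P j k) (shift_biprod C (P i j)) (dg1 A i j k) (dg1 B i j k)"
    by (simp_all add: G_def dsum_tri_def)
  obtain Y where Y: "Y \<in> D n"
    and vY [simp]: "\<And>j. \<lbrakk>1 \<le> j; j \<le> n\<rbrakk> \<Longrightarrow> vtx Y 0 j = vtx G 0 j"
    and hY [simp]: "\<And>j k. \<lbrakk>1 \<le> j; j < k; k \<le> n\<rbrakk> \<Longrightarrow> hor Y 0 j k = hor G 0 j k"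
    using ex_with_base_of[OF n G] by auto
  note Y' = D_tri[OF n Y]
  note [simp] = tri_ob[OF A'] tri_edges[OF A'] tri_ob[OF B'] tri_edges[OF B']
    tri_ob[OF Y'] tri_edges[OF Y']
    biprodD(1-13)[OF P]
  have dsum_hor [simp]: "pr1 (P i k) \<odot> dsum_map C (P i j) (P i k) (hor A i j k) (hor B i j k)
        = hor A i j k \<odot> pr1 (P i j)"
      "pr2 (P i k) \<odot> dsum_map C (P i j) (P i k) (hor A i j k) (hor B i j k)
        = hor B i j k \<odot> pr2 (P i j)"
    if "i < j" "j < k" "k \<le> n" for i j k
    using that dsum_ar[OF P P, of i j i k] by simp_all
  obtain f where f: "is_tri_map C n Y A f" and f0: "\<And>j. \<lbrakk>1 \<le> j; j \<le> n\<rbrakk> \<Longrightarrow> f 0 j = pr1 (P 0 j)"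
    by (rule extend_base_map[OF n Y A, of "\<lambda>j. pr1 (P 0 j)"]) auto
  obtain g where g: "is_tri_map C n Y B g" and g0: "\<And>j. \<lbrakk>1 \<le> j; j \<le> n\<rbrakk> \<Longrightarrow> g 0 j = pr2 (P 0 j)"
    by (rule extend_base_map[OF n Y B, of "\<lambda>j. pr2 (P 0 j)"]) auto
  note [simp] = tri_map_ar[OF f] tri_map_ar[OF g]
  define p where "p i j = pair_into C (P i j) (f i j) (g i j)" for i j
  have p [simp]: "p i j \<in> Ar C" "Dom C (p i j) = vtx Y i j" "Cod C (p i j) = Sm (P i j)"
      "pr1 (P i j) \<odot> p i j = f i j" "pr2 (P i j) \<odot> p i j = g i j"
    if "i < j" "j \<le> n" for i j
    using pair_into_ar[OF P[OF that], of "f i j" "g i j"] that by (simp_all add: p_def)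
  have sp [simp]: "ShA C (pr1 (P i j)) \<odot> ShA C (p i j) = ShA C (f i j)"
      "ShA C (pr2 (P i j)) \<odot> ShA C (p i j) = ShA C (g i j)"
    if "i < j" "j \<le> n" for i j
    using that by (simp_all flip: sh_comp)
  \<comment> \<open>A square into a direct sum commutes if its two components do.\<close>
  have natural: "p' \<odot> e = dsum_map C Q R e1 e2 \<odot> q"
    if Q: "is_biprod C x y Q" and R: "is_biprod C x' y' R"
      and e: "e \<in> Ar C" "e1 \<in> Ar C" "e2 \<in> Ar C" "Dom C e1 = x" "Cod C e1 = x'" "Dom C e2 = y"
        "Cod C e2 = y'"
      and q: "q \<in> Ar C" "Cod C q = Sm Q" "Dom C q = Dom C e"
        "p' \<in> Ar C" "Dom C p' = Cod C e" "Cod C p' = Sm R"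
      and eq: "(pr1 R \<odot> p') \<odot> e = e1 \<odot> (pr1 Q \<odot> q)" "(pr2 R \<odot> p') \<odot> e = e2 \<odot> (pr2 Q \<odot> q)"
    for Q R e e1 e2 q p' x y x' y'
  proof (rule biprod_ext[OF R])
    note [simp] = dsum_ar[OF Q R e(2) e(3) e(4) e(5) e(6) e(7)] biprodD(1-13)[OF Q] biprodD(1-13)[OF R] e q
    have "pr1 R \<odot> (dsum_map C Q R e1 e2 \<odot> q) = e1 \<odot> (pr1 Q \<odot> q)"
      using comp_assoc[of q "dsum_map C Q R e1 e2" "pr1 R"] by (simp add: comp_assoc)
    then show "pr1 R \<odot> (p' \<odot> e) = pr1 R \<odot> (dsum_map C Q R e1 e2 \<odot> q)"
      using eq by (simp add: comp_assoc)
    have "pr2 R \<odot> (dsum_map C Q R e1 e2 \<odot> q) = e2 \<odot> (pr2 Q \<odot> q)"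
      using comp_assoc[of q "dsum_map C Q R e1 e2" "pr2 R"] by (simp add: comp_assoc)
    then show "pr2 R \<odot> (p' \<odot> e) = pr2 R \<odot> (dsum_map C Q R e1 e2 \<odot> q)"
      using eq by (simp add: comp_assoc)
  qed (use e q dsum_ar[OF Q R e(2) e(3) e(4) e(5) e(6) e(7)] in auto)
  have "is_tri_map C n Y G (restr2 n p)"
    unfolding is_tri_map_def
  proof (intro conjI allI impI, goal_cases)
    case (2 i j)
    then show ?case by (simp add: Hom_def)
  next
    case (3 i j k)
    then have l: "i < j" "j < k" "i < k" "j \<le> n" "k \<le> n" by auto
    have "p i k \<odot> hor Y i j k = hor G i j k \<odot> p i j"
      unfolding sel(2)[OF l(1,2,5)]
      by (rule natural[OF P[of i j] P[of i k]])
        (use l tri_map_comm[OF f l(1,2,5)] tri_map_comm[OF g l(1,2,5)] in simp_all)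
    then show ?case using l by simp
  next
    case (4 i j k)
    then have l: "i < j" "j < k" "i < k" "j \<le> n" "k \<le> n" by auto
    have "p j k \<odot> ver Y i j k = ver G i j k \<odot> p i k"
      unfolding sel(3)[OF l(1,2,5)]
      by (rule natural[OF P[of i k] P[of j k]])
        (use l tri_map_comm[OF f l(1,2,5)] tri_map_comm[OF g l(1,2,5)] in simp_all)
    then show ?case using l by simp
  next
    case (5 i j k)
    then have l: "i < j" "j < k" "i < k" "j \<le> n" "k \<le> n" by auto
    have "ShA C (p i j) \<odot> dg1 Y i j k = dg1 G i j k \<odot> p j k"
      unfolding sel(4)[OF l(1,2,5)]
      by (rule natural[OF P[of j k] P'[of i j]])
        (use l tri_map_comm[OF f l(1,2,5)] tri_map_comm[OF g l(1,2,5)] in simp_all)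
    then show ?case using l by simp
  qed simp
  then have "G \<in> D n"
  proof (rule D_recognition[OF n Y G])
    show "vtx Y 0 j = vtx G 0 j \<and> restr2 n p 0 j = Id C (vtx G 0 j)" if "1 \<le> j" "j \<le> n" for j
      using that biprodD(18)[OF P, of 0 j] by (simp add: p_def pair_into_def f0 g0)
    show "face_exact C G i j" if l: "0 < i" "i < j" "j \<le> n" for i j
    proof -
      from l have i: "i \<le> n" "0 < j" by auto
      note ex = D_exact[OF n A l, unfolded face_exact_def] D_exact[OF n B l, unfolded face_exact_def]
      have s: "ShA C (dsum_map C (P 0 i) (P 0 j) (hor A 0 i j) (hor B 0 i j))
        = dsum_map C (shift_biprod C (P 0 i)) (shift_biprod C (P 0 j))
          (ShA C (hor A 0 i j)) (ShA C (hor B 0 i j))"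
        by (rule shift_dsum[OF P P]) (use l i in auto)
      show ?thesis unfolding face_exact_def using l i s ex
        by (simp add: dsum_exact[OF P[of 0 i] P[of 0 j] P[of i j]]
          dsum_exact[OF P[of 0 j] P[of i j] P'[of 0 i]]
          dsum_exact[OF P[of i j] P'[of 0 i] P'[of 0 j]])
    qed
  qed
  then show ?thesis by (simp add: G_def)
qed

end

section \<open>Diagrams generated by their consecutive edges\<close>

context category
begin

lemma path_eq:
  assumes "\<And>t. i \<le> t \<Longrightarrow> t < i + d \<Longrightarrow> e t = E t (Suc t)"
    and "\<And>t. \<lbrakk>i < t; t < i + d\<rbrakk> \<Longrightarrow> E t (Suc t) \<odot> E i t = E i (Suc t)"
    and "0 < d" "E i (Suc i) \<in> Ar C" "Dom C (E i (Suc i)) = x i"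
  shows "path C x e i d = E i (i + d)"
  using assms
proof (induction d)
  case (Suc d)
  then show ?case by (cases "d = 0") auto
qed simp

end

context additive_shift_category
begin

text \<open>In an n-triangle all edges are composites of consecutive ones, so the triangle is recovered from
  these.\<close>

lemma gen_tri_eq:
  assumes G: "is_tri C n G"
    and x: "\<And>i j. \<lbrakk>i < j; j \<le> n\<rbrakk> \<Longrightarrow> x i j = vtx G i j"
    and h: "\<And>i j. \<lbrakk>i < j; Suc j \<le> n\<rbrakk> \<Longrightarrow> h i j = hor G i j (Suc j)"
    and v: "\<And>i j. \<lbrakk>Suc i < j; j \<le> n\<rbrakk> \<Longrightarrow> v i j = ver G i (Suc i) j"
    and w: "\<And>i. \<lbrakk>0 < i; i < n\<rbrakk> \<Longrightarrow> w i = dg1 G 0 i n"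
  shows "gen_tri C n x h v w = G"
proof -
  note [simp] = tri_edges[OF G] tri_ob[OF G]
  have hp: "path C (\<lambda>t. x i t) (\<lambda>t. h i t) j (k - j) = hor G i j k" if "i < j" "j < k" "k \<le> n" for i j k
    using path_eq[of j "k - j" "\<lambda>t. h i t" "hor G i" "\<lambda>t. x i t"] that h x tri_comm(1)[OF G] by auto
  have vp: "path C (\<lambda>t. x t k) (\<lambda>t. v t k) i (j - i) = ver G i j k" if "i < j" "j < k" "k \<le> n" for i j k
    using path_eq[of i "j - i" "\<lambda>t. v t k" "\<lambda>i j. ver G i j k" "\<lambda>t. x t k"] that v x tri_comm(4)[OF G]
    by auto
  show ?thesis
  proof (rule tri_eqI[OF G])
    fix i j k assume l: "i < j" "j < k" "k \<le> n"
    show "hor (gen_tri C n x h v w) i j k = hor G i j k"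
      "ver (gen_tri C n x h v w) i j k = ver G i j k"
      using l by (simp_all add: gen_tri_def hp vp)
    have "ShA C (path C (\<lambda>t. x t j) (\<lambda>t. v t j) 0 i) \<odot> w j \<odot> path C (\<lambda>t. x j t) (\<lambda>t. h j t) k (n - k)
        = dg1 G i j k"
    proof -
      have "ShA C (path C (\<lambda>t. x t j) (\<lambda>t. v t j) 0 i) \<odot> w j = dg1 G i j n"
        using l w[of j] vp[of 0 i j] x[of 0 j] tri_comm(3)[OF G, of 0 i j n]
        by (cases "i = 0") (auto simp: shift_id)
      then show ?thesis
        using l hp[of j k n] x[of j k] tri_comm(2)[OF G, of i j k n] by (cases "k = n") auto
    qed
    then show "dg1 (gen_tri C n x h v w) i j k = dg1 G i j k"
      using l by (simp add: gen_tri_def)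
  qed (use x in \<open>auto simp: gen_tri_def\<close>)
qed

end

section \<open>The 5-triangle of two 2-triangles\<close>

text \<open>Adding a zero object to \<open>y\<close> on the left or to \<open>x\<close> on the right without changing \<open>y\<close> or \<open>x\<close>.  With these
  choices the vertices of a direct sum of diagrams that has single summands at some places are
  those objects themselves, and not merely isomorphic to them.\<close>

definition zero_left :: "('o, 'm, 'z) shift_cat_scheme \<Rightarrow> 'o \<Rightarrow> 'o \<Rightarrow> ('o, 'm) biprod" where
  "zero_left C z y = \<lparr>Sm = y, in1 = Zero C z y, in2 = Id C y, pr1 = Zero C y z, pr2 = Id C y\<rparr>"

definition zero_right :: "('o, 'm, 'z) shift_cat_scheme \<Rightarrow> 'o \<Rightarrow> 'o \<Rightarrow> ('o, 'm) biprod" where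
  "zero_right C x z = \<lparr>Sm = x, in1 = Id C x, in2 = Zero C z x, pr1 = Id C x, pr2 = Zero C x z\<rparr>"

context additive_category
begin

lemma is_biprod_zero_left:
  "\<lbrakk>z \<in> Ob C; y \<in> Ob C; Id C z = Zero C z z\<rbrakk> \<Longrightarrow> is_biprod C z y (zero_left C z y)"
  by (simp add: is_biprod_def zero_left_def Hom_def)

lemma is_biprod_zero_right:
  "\<lbrakk>z \<in> Ob C; x \<in> Ob C; Id C z = Zero C z z\<rbrakk> \<Longrightarrow> is_biprod C x z (zero_right C x z)"
  by (simp add: is_biprod_def zero_right_def Hom_def)

end

lemma pairs_le_5:
  assumes "i < j" "j \<le> (5 :: nat)"
  shows "(i, j) \<in> {(0,1), (0,2), (0,3), (0,4), (0,5), (1,2), (1,3), (1,4), (1,5),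
    (2,3), (2,4), (2,5), (3,4), (3,5), (4,5)}"
proof -
  have "j = 1 \<or> j = 2 \<or> j = 3 \<or> j = 4 \<or> j = 5" using assms by linarith
  moreover have "i = 0 \<or> i = 1 \<or> i = 2 \<or> i = 3 \<or> i = 4" using assms by linarith
  ultimately show ?thesis using assms by (elim disjE) simp_all
qed

theorem lemma4p4:
  fixes C :: "('o, 'm, 'z) shift_cat_scheme"
    and D :: "nat \<Rightarrow> ('o, 'm) tri set"
    and M :: "nat \<Rightarrow> ('o, 'm) tri_map set"
    and S :: "'o \<Rightarrow> 'o \<Rightarrow> ('o, 'm) biprod"
  assumes "fully_triangulated C D M"
    and "\<And>x y. \<lbrakk>x \<in> Ob C; y \<in> Ob C\<rbrakk> \<Longrightarrow> is_biprod C x y (S x y)"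
    and "tri2 a1 b1 c1 u1 v1 w1 \<in> D 2"
    and "tri2 a2 b2 c2 u2 v2 w2 \<in> D 2"
  shows "tri5 C S a1 b1 c1 u1 v1 w1 a2 b2 c2 u2 v2 w2 \<in> D 5"
proof -
  interpret fully_triangulated C D M by fact
  note S = assms(2) and T1 = assms(3) and T2 = assms(4)
  \<comment> \<open>The index maps of the two iterated degeneracies are \<open>0, 0, 1, 2, 2\<close> (for the 4-triangle in \<open>X1\<close>)
    and \<open>0, 1, 1, 1, 2, 2\<close>; so the bases of \<open>X1\<close> and \<open>X2\<close> are \<open>0 \<rightarrow> a1 \<rightarrow> b1 \<rightarrow> b1 \<rightarrow> 0\<close> and
    \<open>a2 \<rightarrow> a2 \<rightarrow> a2 \<rightarrow> b2 \<rightarrow> b2\<close>.\<close>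
  define X1 where "X1 = append_zero C 4 (degen C 4 3 (degen C 3 0 (tri2 a1 b1 c1 u1 v1 w1)))"
  define X2 where "X2 = degen C 5 4 (degen C 4 1 (degen C 3 1 (tri2 a2 b2 c2 u2 v2 w2)))"
  let ?z = "zero_ob C"
  \<comment> \<open>At \<open>(1, 5)\<close> the zero summand is \<open>0[1]\<close>, since it is the shift of the vertex \<open>0\<close> of \<open>X1\<close> at \<open>(0, 1)\<close>.\<close>
  define P where "P = (\<lambda>(i::nat) (j::nat). undefined)
      (0 := (\<lambda>j. undefined)(1 := zero_left C ?z a2, 2 := S a1 a2, 3 := S b1 a2, 4 := S b1 b2,
              5 := zero_left C ?z b2),
       1 := (\<lambda>j. undefined)(2 := zero_right C a1 ?z, 3 := zero_right C b1 ?z, 4 := S b1 c2,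
              5 := zero_left C (ShO C ?z) c2),
       2 := (\<lambda>j. undefined)(3 := zero_right C c1 ?z, 4 := S c1 c2, 5 := S (ShO C a1) c2),
       3 := (\<lambda>j. undefined)(4 := zero_left C ?z c2, 5 := S (ShO C b1) c2),
       4 := (\<lambda>j. undefined)((5::nat) := zero_right C (ShO C b1) ?z))"
  have X1: "X1 \<in> D 5"
    using append_zero_D[of 4] degen_D[of 4 3] degen_D[of 3 0] T1 by (simp add: X1_def)
  have X2: "X2 \<in> D 5"
    using degen_D[of 5 4] degen_D[of 4 1] degen_D[of 3 1] T2 by (simp add: X2_def)
  have [simp]: "a1 \<in> Ob C" "b1 \<in> Ob C" "c1 \<in> Ob C" "a2 \<in> Ob C" "b2 \<in> Ob C" "c2 \<in> Ob C"
    using tri_ob[OF D_tri[OF _ T1], of 0 1] tri_ob[OF D_tri[OF _ T1], of 0 2]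
      tri_ob[OF D_tri[OF _ T1], of 1 2] tri_ob[OF D_tri[OF _ T2], of 0 1]
      tri_ob[OF D_tri[OF _ T2], of 0 2] tri_ob[OF D_tri[OF _ T2], of 1 2]
    by (simp_all add: tri2_def)
  have [simp]: "u1 \<in> Ar C" "Dom C u1 = a1" "Cod C u1 = b1" "v1 \<in> Ar C" "Dom C v1 = b1" "Cod C v1 = c1"
    "w1 \<in> Ar C" "Dom C w1 = c1" "Cod C w1 = ShO C a1"
    "u2 \<in> Ar C" "Dom C u2 = a2" "Cod C u2 = b2" "v2 \<in> Ar C" "Dom C v2 = b2" "Cod C v2 = c2"
    "w2 \<in> Ar C" "Dom C w2 = c2" "Cod C w2 = ShO C a2"
    using tri_edges[OF D_tri[OF _ T1], of 0 1 2] tri_edges[OF D_tri[OF _ T2], of 0 1 2]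
    by (simp_all add: tri2_def)
  note defs = X1_def X2_def append_zero_def degen_def degen_vtx_def Let_def codegen_def tri2_def
  have vtx_X [simp]:
    "vtx X1 0 (Suc 0) = ?z" "vtx X1 0 2 = a1" "vtx X1 0 3 = b1" "vtx X1 0 4 = b1" "vtx X1 0 5 = ?z"
    "vtx X1 (Suc 0) 2 = a1" "vtx X1 (Suc 0) 3 = b1" "vtx X1 (Suc 0) 4 = b1" "vtx X1 (Suc 0) 5 = ShO C ?z"
    "vtx X1 2 3 = c1" "vtx X1 2 4 = c1" "vtx X1 2 5 = ShO C a1" "vtx X1 3 4 = ?z"
    "vtx X1 3 5 = ShO C b1" "vtx X1 4 5 = ShO C b1"
    "vtx X2 0 (Suc 0) = a2" "vtx X2 0 2 = a2" "vtx X2 0 3 = a2" "vtx X2 0 4 = b2" "vtx X2 0 5 = b2"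
    "vtx X2 (Suc 0) 2 = ?z" "vtx X2 (Suc 0) 3 = ?z" "vtx X2 (Suc 0) 4 = c2" "vtx X2 (Suc 0) 5 = c2"
    "vtx X2 2 3 = ?z" "vtx X2 2 4 = c2" "vtx X2 2 5 = c2" "vtx X2 3 4 = c2" "vtx X2 3 5 = c2"
    "vtx X2 4 5 = ?z"
    by (simp_all add: defs)
  have hor_X [simp]:
    "hor X1 0 (Suc 0) 2 = Zero C ?z a1" "hor X1 0 2 3 = u1" "hor X1 0 3 4 = Id C b1"
    "hor X1 0 4 5 = Zero C b1 ?z" "hor X1 (Suc 0) 2 3 = u1" "hor X1 (Suc 0) 3 4 = Id C b1"
    "hor X1 (Suc 0) 4 5 = Zero C b1 (ShO C ?z)" "hor X1 2 3 4 = Id C c1" "hor X1 2 4 5 = w1"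
    "hor X1 3 4 5 = Zero C ?z (ShO C b1)"
    "hor X2 0 (Suc 0) 2 = Id C a2" "hor X2 0 2 3 = Id C a2" "hor X2 0 3 4 = u2"
    "hor X2 0 4 5 = Id C b2" "hor X2 (Suc 0) 2 3 = Zero C ?z ?z" "hor X2 (Suc 0) 3 4 = Zero C ?z c2"
    "hor X2 (Suc 0) 4 5 = Id C c2" "hor X2 2 3 4 = Zero C ?z c2" "hor X2 2 4 5 = Id C c2"
    "hor X2 3 4 5 = Id C c2"
    by (simp_all add: defs id_zero_ob)
  have ver_X [simp]:
    "ver X1 0 (Suc 0) 2 = Id C a1" "ver X1 0 (Suc 0) 3 = Id C b1" "ver X1 0 (Suc 0) 4 = Id C b1"
    "ver X1 0 (Suc 0) 5 = Zero C ?z (ShO C ?z)" "ver X1 (Suc 0) 2 3 = v1" "ver X1 (Suc 0) 2 4 = v1"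
    "ver X1 (Suc 0) 2 5 = Zero C (ShO C ?z) (ShO C a1)" "ver X1 2 3 4 = Zero C c1 ?z"
    "ver X1 2 3 5 = ShA C u1" "ver X1 3 4 5 = Id C (ShO C b1)"
    "ver X2 0 (Suc 0) 2 = Zero C a2 ?z" "ver X2 0 (Suc 0) 3 = Zero C a2 ?z"
    "ver X2 0 (Suc 0) 4 = v2" "ver X2 0 (Suc 0) 5 = v2" "ver X2 (Suc 0) 2 3 = Zero C ?z ?z"
    "ver X2 (Suc 0) 2 4 = Id C c2" "ver X2 (Suc 0) 2 5 = Id C c2" "ver X2 2 3 4 = Id C c2"
    "ver X2 2 3 5 = Id C c2" "ver X2 3 4 5 = Zero C c2 ?z"
    by (simp_all add: defs id_zero_ob shift_id)
  have dg1_X [simp]: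
    "dg1 X1 0 (Suc 0) 5 = Id C (ShO C ?z)" "dg1 X1 0 2 5 = Id C (ShO C a1)"
    "dg1 X1 0 3 5 = Id C (ShO C b1)" "dg1 X1 0 4 5 = Id C (ShO C b1)"
    "dg1 X2 0 (Suc 0) 5 = w2" "dg1 X2 0 2 5 = w2" "dg1 X2 0 3 5 = w2"
    "dg1 X2 0 4 5 = Zero C ?z (ShO C b2)"
    by (simp_all add: defs)
  have P: "is_biprod C (vtx X1 i j) (vtx X2 i j) (P i j)" if "i < j" "j \<le> 5" for i j
    using pairs_le_5[OF that] S is_biprod_zero_left is_biprod_zero_right id_zero_ob id_zero_ob_sh
    by (auto simp: P_def)
  define G where "G = dsum_tri C 5 P X1 X2"
  have GD: "G \<in> D 5" unfolding G_def by (rule dsum_tri_D[OF _ X1 X2 P]) simp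
  note SD [simp] = biprodD(1-13)[OF S]
  note defs' = G_def dsum_tri_def P_def zero_left_def zero_right_def dsum_map_def shift_id sh_comp
    numeral_2_eq_2[symmetric]
  have "tri5 C S a1 b1 c1 u1 v1 w1 a2 b2 c2 u2 v2 w2 = G"
    unfolding tri5_def Let_def
  proof (rule gen_tri_eq[OF D_tri[OF _ GD]], goal_cases)
    case (2 i j)
    show ?case using pairs_le_5[OF 2] by (auto simp: defs')
  next
    case (3 i j)
    then show ?case using pairs_le_5[of i j] by (auto simp: defs')
  next
    case (4 i j)
    then show ?case using pairs_le_5[of i j] by (auto simp: defs')
  next
    case (5 i)
    then have "i = 1 \<or> i = 2 \<or> i = 3 \<or> i = 4" by linarith
    then show ?case by (auto simp: defs')
  qed simp
  with GD show ?thesis by simp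
qed

end
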